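(* The group $Fr(162\times 4)=\langle G_1,G_2,FUM\rangle\subset SU(3)$ is finite of order $648$ and contains $Fr(162)=\langle G_1,G_2\rangle$ (a group isomorphic to $D(9,1,1;2,1,1)$) as a subgroup. More precisely: (a) $\mathcal N\mathcal V=\{NT: N\in\mathcal N, T\in\mathcal V\}$ is a normal subgroup of $Fr(162\times 4)$, isomorphic to $\mathcal N\times\mathcal V\cong \mathbb Z/18\mathbb Z\times\mathbb Z/6\mathbb Z$; $\mathcal H$ is a subgroup isomorphic to $S_3$; $\mathcal N\mathcal V\cap\mathcal H=\{I_3\}$; and $Fr(162\times 4)=(\mathcal N\mathcal V)\rtimes\mathcal H$, the action being by conjugation. (b) Every element of $Fr(162\times 4)$ can be written uniquely as $A^iB^jTH$ with $0\le i\le 8$, $0\le j\le 2$, $T\in\mathcal V$, $H\in\mathcal H$. (c) With $C_{18}=A\,(FUM)^3$ and $C_6=B\,G_1(FUM)^3G_1^{-1}$, the group $Fr(162\times 4)$ has the presentation $$\left\langle C_6,C_{18},H_1,H_3\ \middle|\ \begin{array}{l}C_6^6=C_{18}^{18}=[C_6,C_{18}]=H_1^2=H_3^3=(H_1H_3)^2=1,\\ H_1C_6H_1^{-1}=C_6^{-1}C_{18}^6,\quad H_1C_{18}H_1^{-1}=C_6^3C_{18},\\ H_3C_6H_3^{-1}=C_6C_{18}^{-3},\quad H_3C_{18}H_3^{-1}=C_6C_{18}^{10}\end{array}\right\rangle .$$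
   Context: Let $\omega=e^{2i\pi/3}$ and let $J$ be the $3\times3$ antidiagonal matrix with all antidiagonal entries $1$. Define $G_1=\mathrm{diag}(e^{7i\pi/9},-e^{4i\pi/9},-e^{7i\pi/9})$, $G_2=\begin{pmatrix}-\tfrac12 e^{4i\pi/9}&\tfrac{1}{\sqrt2}e^{7i\pi/9}&\tfrac12 e^{4i\pi/9}\\ \tfrac{1}{\sqrt2}e^{7i\pi/9}&0&\tfrac{1}{\sqrt2}e^{7i\pi/9}\\ \tfrac12 e^{4i\pi/9}&\tfrac{1}{\sqrt2}e^{7i\pi/9}&-\tfrac12 e^{4i\pi/9}\end{pmatrix}$, $FUM=-\omega J$. Let $A=\tfrac12 e^{5i\pi/9}\begin{pmatrix}-1+e^{i\pi/3}&0&1+e^{i\pi/3}\\0&-2&0\\1+e^{i\pi/3}&0&-1+e^{i\pi/3}\end{pmatrix}$ and $B=\tfrac12\begin{pmatrix}1+\omega&0&-1+\omega\\0&-2e^{i\pi/3}&0\\-1+\omega&0&1+\omega\end{pmatrix}$ (one has $A=G_1G_2^2G_1^{-1}$, $B=G_1G_2^{-2}G_1$), and $\mathcal N=\langle A,B\rangle$. Let $H_0=\mathrm{diag}(-1,-1,1)$, $H_1=\begin{pmatrix}-\frac12&-\frac1{\sqrt2}&-\frac12\\-\frac1{\sqrt2}&0&\frac1{\sqrt2}\\-\frac12&\frac1{\sqrt2}&-\frac12\end{pmatrix}$, $H_2=\begin{pmatrix}-\frac12&-\frac1{\sqrt2}&\frac12\\-\frac1{\sqrt2}&0&-\frac1{\sqrt2}\\\frac12&-\frac1{\sqrt2}&-\frac12\end{pmatrix}$,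 $H_3=\begin{pmatrix}\frac12&\frac1{\sqrt2}&-\frac12\\\frac1{\sqrt2}&0&\frac1{\sqrt2}\\\frac12&-\frac1{\sqrt2}&-\frac12\end{pmatrix}$, $H_4=\begin{pmatrix}\frac12&\frac1{\sqrt2}&\frac12\\\frac1{\sqrt2}&0&-\frac1{\sqrt2}\\-\frac12&\frac1{\sqrt2}&-\frac12\end{pmatrix}$, and $\mathcal H=\{I_3,H_0,H_1,H_2,H_3,H_4\}$. Let $\mathcal V=\{I_3,V_2,V_3,V_4\}$ with $V_2=(FUM)^3=-J$, $V_3=G_1(FUM)^3G_1^{-1}=\begin{pmatrix}0&0&1\\0&-1&0\\1&0&0\end{pmatrix}$, $V_4=V_3V_2=\mathrm{diag}(-1,1,-1)$ (a Klein four-group). $D(9,1,1;2,1,1)$ is the subgroup of $SU(3)$ generated by $\mathrm{diag}(e^{2i\pi/9},e^{2i\pi/9},e^{-4i\pi/9})$, $E=\begin{pmatrix}0&1&0\\0&0&1\\1&0&0\end{pmatrix}$ and $\tilde B=\begin{pmatrix}-1&0&0\\0&0&-1\\0&-1&0\end{pmatrix}$. *)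

theory Defs
  imports "HOL-Analysis.Analysis" "HOL-Algebra.Algebra"
begin

section \<open>Ambient group SU(3) of 3x3 complex matrices\<close>

type_synonym cmat3 = "complex^3^3"

definition ctrans :: "cmat3 \<Rightarrow> cmat3" where
  "ctrans M = (\<chi> i j. cnj (M $ j $ i))"

definition SU3 :: "cmat3 monoid" where
  "SU3 = \<lparr> carrier = {M. ctrans M ** M = mat 1 \<and> det M = 1},
           mult = (**), one = mat 1 \<rparr>"

section \<open>The concrete matrices\<close>

abbreviation rt2inv :: complex where "rt2inv \<equiv> complex_of_real (1 / sqrt 2)"

definition omega :: complex where "omega = cis (2 * pi / 3)"

definition Jm :: cmat3 where
  "Jm = vector [vector [0,0,1], vector [0,1,0], vector [1,0,0]]"

definition G1 :: cmat3 where
  "G1 = vector [vector [cis (7*pi/9), 0, 0],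
                vector [0, - cis (4*pi/9), 0],
                vector [0, 0, - cis (7*pi/9)]]"

definition G2 :: cmat3 where
  "G2 = vector [vector [- (1/2) * cis (4*pi/9), rt2inv * cis (7*pi/9), (1/2) * cis (4*pi/9)],
                vector [rt2inv * cis (7*pi/9), 0, rt2inv * cis (7*pi/9)],
                vector [(1/2) * cis (4*pi/9), rt2inv * cis (7*pi/9), - (1/2) * cis (4*pi/9)]]"

definition FUM :: cmat3 where
  "FUM = (\<chi> i j. - omega * Jm $ i $ j)"

definition Amat :: cmat3 where
  "Amat = (\<chi> i j. (1/2) * cis (5*pi/9) *
      (vector [vector [-1 + cis (pi/3), 0, 1 + cis (pi/3)],
               vector [0, -2, 0],
               vector [1 + cis (pi/3), 0, -1 + cis (pi/3)]] :: cmat3) $ i $ j)"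

definition Bmat :: cmat3 where
  "Bmat = (\<chi> i j. (1/2) *
      (vector [vector [1 + omega, 0, -1 + omega],
               vector [0, -2 * cis (pi/3), 0],
               vector [-1 + omega, 0, 1 + omega]] :: cmat3) $ i $ j)"

definition H0 :: cmat3 where
  "H0 = vector [vector [-1,0,0], vector [0,-1,0], vector [0,0,1]]"

definition H1 :: cmat3 where
  "H1 = vector [vector [-1/2, - rt2inv, -1/2],
                vector [- rt2inv, 0, rt2inv],
                vector [-1/2, rt2inv, -1/2]]"

definition H2 :: cmat3 where
  "H2 = vector [vector [-1/2, - rt2inv, 1/2],
                vector [- rt2inv, 0, - rt2inv],
                vector [1/2, - rt2inv, -1/2]]"

definition H3 :: cmat3 where
  "H3 = vector [vector [1/2, rt2inv, -1/2],
                vector [rt2inv, 0, rt2inv],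
                vector [1/2, - rt2inv, -1/2]]"

definition H4 :: cmat3 where
  "H4 = vector [vector [1/2, rt2inv, 1/2],
                vector [rt2inv, 0, - rt2inv],
                vector [-1/2, rt2inv, -1/2]]"

definition Hset :: "cmat3 set" where
  "Hset = {mat 1, H0, H1, H2, H3, H4}"

text \<open>V2 = FUM^3, V3 = G1 FUM^3 G1^-1, V4 = V3 V2.\<close>
definition V2 :: cmat3 where "V2 = FUM ** FUM ** FUM"
definition V3 :: cmat3 where "V3 = G1 ** (FUM ** FUM ** FUM) ** matrix_inv G1"
definition V4 :: cmat3 where "V4 = V3 ** V2"

definition Vset :: "cmat3 set" where
  "Vset = {mat 1, V2, V3, V4}"

definition Nset :: "cmat3 set" where
  "Nset = generate SU3 {Amat, Bmat}"

definition NVset :: "cmat3 set" where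
  "NVset = {N ** T | N T. N \<in> Nset \<and> T \<in> Vset}"

definition Fr648 :: "cmat3 set" where
  "Fr648 = generate SU3 {G1, G2, FUM}"

definition Fr162 :: "cmat3 set" where
  "Fr162 = generate SU3 {G1, G2}"

definition D9 :: "cmat3 set" where
  "D9 = generate SU3
     {vector [vector [cis (2*pi/9), 0, 0], vector [0, cis (2*pi/9), 0], vector [0, 0, cis (-4*pi/9)]],
      vector [vector [0,1,0], vector [0,0,1], vector [1,0,0]],
      vector [vector [-1,0,0], vector [0,0,-1], vector [0,-1,0]]}"

definition C18 :: cmat3 where "C18 = Amat ** (FUM ** FUM ** FUM)"
definition C6 :: cmat3 where "C6 = Bmat ** (G1 ** (FUM ** FUM ** FUM) ** matrix_inv G1)"

section \<open>Relations of the presentation, in an arbitrary group K\<close>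

definition pres_rels :: "('g, 'b) monoid_scheme \<Rightarrow> 'g \<Rightarrow> 'g \<Rightarrow> 'g \<Rightarrow> 'g \<Rightarrow> bool" where
  "pres_rels K c6 c18 h1 h3 \<longleftrightarrow>
     c6 [^]\<^bsub>K\<^esub> (6::nat) = \<one>\<^bsub>K\<^esub> \<and>
     c18 [^]\<^bsub>K\<^esub> (18::nat) = \<one>\<^bsub>K\<^esub> \<and>
     c6 \<otimes>\<^bsub>K\<^esub> c18 \<otimes>\<^bsub>K\<^esub> inv\<^bsub>K\<^esub> c6 \<otimes>\<^bsub>K\<^esub> inv\<^bsub>K\<^esub> c18 = \<one>\<^bsub>K\<^esub> \<and>
     h1 [^]\<^bsub>K\<^esub> (2::nat) = \<one>\<^bsub>K\<^esub> \<and>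
     h3 [^]\<^bsub>K\<^esub> (3::nat) = \<one>\<^bsub>K\<^esub> \<and>
     (h1 \<otimes>\<^bsub>K\<^esub> h3) [^]\<^bsub>K\<^esub> (2::nat) = \<one>\<^bsub>K\<^esub> \<and>
     h1 \<otimes>\<^bsub>K\<^esub> c6 \<otimes>\<^bsub>K\<^esub> inv\<^bsub>K\<^esub> h1 = inv\<^bsub>K\<^esub> c6 \<otimes>\<^bsub>K\<^esub> c18 [^]\<^bsub>K\<^esub> (6::nat) \<and>
     h1 \<otimes>\<^bsub>K\<^esub> c18 \<otimes>\<^bsub>K\<^esub> inv\<^bsub>K\<^esub> h1 = c6 [^]\<^bsub>K\<^esub> (3::nat) \<otimes>\<^bsub>K\<^esub> c18 \<and>
     h3 \<otimes>\<^bsub>K\<^esub> c6 \<otimes>\<^bsub>K\<^esub> inv\<^bsub>K\<^esub> h3 = c6 \<otimes>\<^bsub>K\<^esub> inv\<^bsub>K\<^esub> (c18 [^]\<^bsub>K\<^esub> (3::nat)) \<and>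
     h3 \<otimes>\<^bsub>K\<^esub> c18 \<otimes>\<^bsub>K\<^esub> inv\<^bsub>K\<^esub> h3 = c6 \<otimes>\<^bsub>K\<^esub> c18 [^]\<^bsub>K\<^esub> (10::nat)"

end

theory Submission
  imports Defs
begin

text \<open>
  In a suitable orthonormal basis all matrices become monomial, with nonzero entries among the
  eighteenth roots of unity: every element of the big group is \<open>Em a b c ** H\<close> with \<open>H\<close> in the
  copy \<open>Hset\<close> of the symmetric group and \<open>Em a b c\<close> diagonalisable with eigenvalues
  \<open>exp (i \<pi> a / 9)\<close>, \<open>exp (i \<pi> b / 9)\<close>, \<open>exp (i \<pi> c / 9)\<close>, the exponents ranging over the
  lattice \<open>a + b + c \<equiv> 0 (mod 18)\<close>, \<open>a \<equiv> b \<equiv> c (mod 3)\<close>; conjugation by \<open>H\<close> permutes the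
  exponents. Even exponents give \<open>Fr162\<close> and \<open>Nset\<close>, multiples of nine give \<open>Vset\<close>. All group
  statements thereby become congruences between exponents.

  For the presentation, let \<open>K\<close> be a group with elements satisfying the relations. In the subgroup
  of \<open>SU3 \<times>\<times> K\<close> generated by the four pairs of generators, the relations bring every element into
  the form \<open>c6^i c18^j h1^k h3^l\<close>. Such an element with trivial first component has exponents
  divisible by the orders, so it is trivial: the subgroup is the graph of the required homomorphism.
\<close>

section \<open>Three by three matrices\<close>

abbreviation mat3 :: "complex \<Rightarrow> complex \<Rightarrow> complex \<Rightarrow> complex \<Rightarrow> complex \<Rightarrow> complex \<Rightarrow>
    complex \<Rightarrow> complex \<Rightarrow> complex \<Rightarrow> cmat3" where
  "mat3 a b c d e f g h i \<equiv> vector [vector [a, b, c], vector [d, e, f], vector [g, h, i]]"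

lemma mat3_eq_iff:
  "mat3 a b c d e f g h i = mat3 a' b' c' d' e' f' g' h' i' \<longleftrightarrow>
   a = a' \<and> b = b' \<and> c = c' \<and> d = d' \<and> e = e' \<and> f = f' \<and> g = g' \<and> h = h' \<and> i = i'"
  by (simp add: vec_eq_iff forall_3 conj_assoc)

lemma mat3_mult:
  "mat3 a b c d e f g h i ** mat3 a' b' c' d' e' f' g' h' i' =
   mat3 (a * a' + b * d' + c * g') (a * b' + b * e' + c * h') (a * c' + b * f' + c * i')
        (d * a' + e * d' + f * g') (d * b' + e * e' + f * h') (d * c' + e * f' + f * i')
        (g * a' + h * d' + i * g') (g * b' + h * e' + i * h') (g * c' + h * f' + i * i')"
  by (simp add: vec_eq_iff forall_3 matrix_matrix_mult_def sum_3)

lemma mat3_one: "mat 1 = mat3 1 0 0 0 1 0 0 0 1"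
  by (simp add: vec_eq_iff forall_3 mat_def)

lemma ctrans_mat3:
  "ctrans (mat3 a b c d e f g h i) =
   mat3 (cnj a) (cnj d) (cnj g) (cnj b) (cnj e) (cnj h) (cnj c) (cnj f) (cnj i)"
  by (simp add: ctrans_def vec_eq_iff forall_3)

lemma det_mat3:
  "det (mat3 a b c d e f g h i) =
   a * e * i + b * f * g + c * d * h - a * f * h - b * d * i - c * e * g"
  by (simp add: det_3)

lemma scale_mat3:
  "(\<chi> i j. k * mat3 a b c d e f g h l $ i $ j) =
   mat3 (k * a) (k * b) (k * c) (k * d) (k * e) (k * f) (k * g) (k * h) (k * l)"
  by (simp add: vec_eq_iff forall_3)

section \<open>The group SU(3)\<close>

lemma ctrans_mult: "ctrans (M ** N) = ctrans N ** ctrans M"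
  by (simp add: ctrans_def matrix_matrix_mult_def vec_eq_iff mult.commute)

lemma ctrans_ctrans: "ctrans (ctrans M) = M"
  by (simp add: ctrans_def vec_eq_iff)

lemma SU3_simps [simp]: "x \<otimes>\<^bsub>SU3\<^esub> y = x ** y" "\<one>\<^bsub>SU3\<^esub> = mat 1"
  by (simp_all add: SU3_def)

lemma SU3_carrier: "M \<in> carrier SU3 \<longleftrightarrow> ctrans M ** M = mat 1 \<and> det M = 1"
  by (simp add: SU3_def)

lemma ctrans_one: "ctrans (mat 1) = mat 1"
  by (simp add: mat3_one ctrans_mat3)

lemma SU3_ctrans:
  assumes "M \<in> carrier SU3"
  shows "ctrans M \<in> carrier SU3"
proof -
  have M: "ctrans M ** M = mat 1" "det M = 1"
    using assms by (simp_all add: SU3_carrier)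
  have "det (ctrans M) * det M = 1"
    by (metis M(1) det_I det_mul)
  with M show ?thesis
    by (simp add: SU3_carrier ctrans_ctrans matrix_left_right_inverse)
qed

lemma group_SU3: "group SU3"
proof (rule groupI)
  fix x y assume xy: "x \<in> carrier SU3" "y \<in> carrier SU3"
  have "ctrans (x ** y) ** (x ** y) = ctrans y ** (ctrans x ** x) ** y"
    by (simp add: ctrans_mult matrix_mul_assoc)
  with xy show "x \<otimes>\<^bsub>SU3\<^esub> y \<in> carrier SU3"
    by (simp add: SU3_carrier det_mul)
next
  fix x assume "x \<in> carrier SU3"
  then show "\<exists>y\<in>carrier SU3. y \<otimes>\<^bsub>SU3\<^esub> x = \<one>\<^bsub>SU3\<^esub>"
    by (intro bexI[of _ "ctrans x"] SU3_ctrans) (simp_all add: SU3_carrier)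
qed (simp_all add: SU3_carrier ctrans_one matrix_mul_assoc)

interpretation SU3: group SU3
  by (rule group_SU3)

lemma inv_SU3_unique:
  assumes "M \<in> carrier SU3" "N \<in> carrier SU3" "M ** N = mat 1"
  shows "inv\<^bsub>SU3\<^esub> M = N"
  using assms SU3.inv_equality[of N M] by (simp add: matrix_left_right_inverse)

lemma matrix_inv_unique:
  fixes M N :: cmat3
  assumes "M ** N = mat 1"
  shows "matrix_inv M = N"
proof -
  have "N ** M = mat 1"
    using assms matrix_left_right_inverse by blast
  moreover from this assms have "M ** matrix_inv M = mat 1"
    unfolding matrix_inv_def by (metis (mono_tags, lifting) someI_ex)
  ultimately show ?thesis
    by (metis matrix_mul_assoc matrix_mul_lid matrix_mul_rid)
qed

section \<open>The eighteenth roots of unity\<close>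

text \<open>Integer indices turn complex conjugation into negation and equality into congruence
  modulo 18.\<close>

definition zeta :: "int \<Rightarrow> complex" where
  "zeta a = cis (of_int a * pi / 9)"

lemma zeta_0 [simp]: "zeta 0 = 1"
  by (simp add: zeta_def)

lemma zeta_add: "zeta (a + b) = zeta a * zeta b"
  by (simp add: zeta_def cis_mult ring_distribs add_divide_distrib)

lemma cnj_zeta: "cnj (zeta a) = zeta (- a)"
  by (simp add: zeta_def cis_cnj)

lemma zeta_nonzero [simp]: "zeta a \<noteq> 0"
  by (simp add: zeta_def)

lemma zeta_eq_1_iff: "zeta a = 1 \<longleftrightarrow> 18 dvd a"
proof
  assume "zeta a = 1"
  then have "cos (of_int a * pi / 9) = 1"
    by (simp add: zeta_def complex_eq_iff)
  then obtain n :: int where "of_int a * pi / 9 = of_int n * 2 * pi"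
    by (auto simp: cos_one_2pi_int)
  then have "real_of_int a = of_int (n * 18)"
    by (simp add: field_simps)
  then have "a = n * 18"
    by linarith
  then show "18 dvd a" by simp
next
  assume "18 dvd a"
  then obtain n where "a = 18 * n" ..
  then have "zeta a = cis (2 * pi * of_int n)"
    by (simp add: zeta_def algebra_simps)
  then show "zeta a = 1" by simp
qed

lemma zeta_eq_iff: "zeta a = zeta b \<longleftrightarrow> 18 dvd (a - b)"
proof -
  have "zeta a = zeta (a - b) * zeta b"
    by (simp flip: zeta_add)
  then show ?thesis
    by (simp flip: zeta_eq_1_iff)
qed

lemma zeta_9: "zeta 9 = -1"
  by (simp add: zeta_def)

lemma zeta_add_9: "zeta (a + 9) = - zeta a"
  by (simp add: zeta_add zeta_9)

text \<open>Exponents brought below 9, at the cost of a sign, make equal matrix entries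
  syntactically equal.\<close>

lemma zeta_high:
  "zeta 16 = - zeta 7" "zeta 13 = - zeta 4" "zeta 14 = - zeta 5" "zeta 17 = - zeta 8"
  "zeta 12 = - zeta 3" "zeta 15 = - zeta 6"
  using zeta_add_9[of 7] zeta_add_9[of 4] zeta_add_9[of 5] zeta_add_9[of 8] zeta_add_9[of 3]
    zeta_add_9[of 6] by simp_all

lemma zeta_cis:
  "cis (7 * pi / 9) = zeta 7" "cis (4 * pi / 9) = zeta 4" "cis (5 * pi / 9) = zeta 5"
  "cis (pi / 3) = zeta 3" "omega = zeta 6" "cis (2 * pi / 9) = zeta 2"
  "cis (- 4 * pi / 9) = zeta (- 4)"
  by (simp_all add: zeta_def omega_def)

text \<open>An opaque name for 1/sqrt 2: the simplifier then computes with \<open>rt_rt\<close>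
  alone and does not rewrite the root.\<close>

definition rt :: complex where
  "rt = rt2inv"

lemma rt_rt: "rt * rt = 1 / 2"
  by (simp add: rt_def flip: of_real_mult)

lemma rt_rt_left: "rt * (rt * w) = w / 2"
  by (simp add: rt_rt flip: mult.assoc)

lemma cnj_rt: "cnj rt = rt"
  by (simp add: rt_def)

lemma rt_nonzero: "rt \<noteq> 0"
  using rt_rt by auto

section \<open>Matrices commuting with J, and the action of the copy of S3\<close>

text \<open>The basis change \<open>Qm\<close> diagonalises all matrices \<open>dg x y z\<close>
  simultaneously and turns the elements of \<open>Hset\<close> into permutation matrices multiplied by
  their signs.\<close>

definition Qm :: cmat3 where
  "Qm = mat3 rt 0 rt 0 1 0 rt 0 (- rt)"

text \<open>The matrix with eigenvalues \<open>x\<close>, \<open>y\<close>, \<open>z\<close> on e1 +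
  e3, e2, e1 - e3, which are the columns of \<open>Qm\<close> up to scale.\<close>

definition dg :: "complex \<Rightarrow> complex \<Rightarrow> complex \<Rightarrow> cmat3" where
  "dg x y z = mat3 ((x + z) / 2) 0 ((x - z) / 2) 0 y 0 ((x - z) / 2) 0 ((x + z) / 2)"

definition Em :: "int \<Rightarrow> int \<Rightarrow> int \<Rightarrow> cmat3" where
  "Em a b c = dg (zeta a) (zeta b) (zeta c)"

lemma Qm_Qm: "Qm ** Qm = mat 1"
  by (simp add: Qm_def mat3_mult mat3_one mat3_eq_iff rt_rt)

lemma Qm_diag: "Qm ** mat3 x 0 0 0 y 0 0 0 z ** Qm = dg x y z"
  by (simp add: Qm_def mat3_mult mat3_eq_iff dg_def algebra_simps rt_rt rt_rt_left
      diff_divide_distrib add_divide_distrib)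

lemma dg_mult: "dg x y z ** dg x' y' z' = dg (x * x') (y * y') (z * z')"
  by (simp add: dg_def mat3_mult mat3_eq_iff field_simps)

lemma dg_eq_iff: "dg x y z = dg x' y' z' \<longleftrightarrow> x = x' \<and> y = y' \<and> z = z'"
proof
  assume "dg x y z = dg x' y' z'"
  then have eq: "(x + z) / 2 = (x' + z') / 2" "(x - z) / 2 = (x' - z') / 2" "y = y'"
    unfolding dg_def mat3_eq_iff by blast+
  \<comment> \<open>The outer eigenvalues are the sum and the difference of the two corner
    entries.\<close>
  have "x = (x + z) / 2 + (x - z) / 2" "z = (x + z) / 2 - (x - z) / 2" for x z :: complex
    by (simp_all add: field_simps)
  with eq show "x = x' \<and> y = y' \<and> z = z'"
    by metis
qed simp

lemma Em_mult: "Em a b c ** Em a' b' c' = Em (a + a') (b + b') (c + c')"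
  by (simp add: Em_def dg_mult zeta_add)

lemma Em_eq_iff: "Em a b c = Em a' b' c' \<longleftrightarrow> 18 dvd (a - a') \<and> 18 dvd (b - b') \<and> 18 dvd (c - c')"
  by (simp add: Em_def dg_eq_iff zeta_eq_iff)

lemma Em_0: "Em 0 0 0 = mat 1"
  by (simp add: Em_def dg_def mat3_one mat3_eq_iff)

lemma Em_eq_1_iff: "Em a b c = mat 1 \<longleftrightarrow> 18 dvd a \<and> 18 dvd b \<and> 18 dvd c"
  using Em_eq_iff[of a b c 0 0 0] by (simp add: Em_0)

lemma ctrans_Em: "ctrans (Em a b c) = Em (- a) (- b) (- c)"
  by (simp add: Em_def dg_def ctrans_mat3 cnj_zeta)

lemma det_Em: "det (Em a b c) = zeta (a + b + c)"
  by (simp add: Em_def dg_def det_mat3 zeta_add field_simps)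

text \<open>Unitarity is automatic, so only the determinant \<open>zeta (a + b + c)\<close> imposes
  a condition.\<close>

lemma Em_in_SU3: "Em a b c \<in> carrier SU3 \<longleftrightarrow> 18 dvd (a + b + c)"
  by (simp add: SU3_carrier ctrans_Em Em_mult Em_0 det_Em zeta_eq_1_iff)

section \<open>The copy of S3 as signed permutations of the eigenlines\<close>

lemma H_mat3:
  "H0 = mat3 (-1) 0 0 0 (-1) 0 0 0 1"
  "H1 = mat3 (-1/2) (- rt) (-1/2) (- rt) 0 rt (-1/2) rt (-1/2)"
  "H2 = mat3 (-1/2) (- rt) (1/2) (- rt) 0 (- rt) (1/2) (- rt) (-1/2)"
  "H3 = mat3 (1/2) rt (-1/2) rt 0 rt (1/2) (- rt) (-1/2)"
  "H4 = mat3 (1/2) rt (1/2) rt 0 (- rt) (-1/2) rt (-1/2)"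
  by (simp_all only: H0_def H1_def H2_def H3_def H4_def rt_def)

text \<open>In the eigenbasis each \<open>H\<close> is a permutation matrix up to signs, and the
  signs cancel under conjugation, so only a permutation of the eigenvalues remains.\<close>

lemma H_dg:
  "H0 ** dg x y z = dg z y x ** H0"
  "H1 ** dg x y z = dg x z y ** H1"
  "H2 ** dg x y z = dg y x z ** H2"
  "H3 ** dg x y z = dg z x y ** H3"
  "H4 ** dg x y z = dg y z x ** H4"
  by (simp_all add: H_mat3 dg_def mat3_mult mat3_eq_iff field_simps)

lemmas H_Em = H_dg[of "zeta a" "zeta b" "zeta c" for a b c, folded Em_def]

text \<open>The signs are consistent: the five matrices and the identity close up to S3 itself, with
  \<open>H0\<close>, \<open>H1\<close>, \<open>H2\<close> as transpositions and \<open>H3\<close>,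
  \<open>H4\<close> as the mutually inverse 3-cycles.\<close>

lemma H_table:
  "H0 ** H0 = mat 1" "H0 ** H1 = H4" "H0 ** H2 = H3" "H0 ** H3 = H2" "H0 ** H4 = H1"
  "H1 ** H0 = H3" "H1 ** H1 = mat 1" "H1 ** H2 = H4" "H1 ** H3 = H0" "H1 ** H4 = H2"
  "H2 ** H0 = H4" "H2 ** H1 = H3" "H2 ** H2 = mat 1" "H2 ** H3 = H1" "H2 ** H4 = H0"
  "H3 ** H0 = H1" "H3 ** H1 = H2" "H3 ** H2 = H0" "H3 ** H3 = H4" "H3 ** H4 = mat 1"
  "H4 ** H0 = H2" "H4 ** H1 = H0" "H4 ** H2 = H1" "H4 ** H3 = mat 1" "H4 ** H4 = H3"
  by (simp_all add: H_mat3 mat3_mult mat3_one mat3_eq_iff rt_rt)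

lemma H_in_SU3: "H0 \<in> carrier SU3" "H1 \<in> carrier SU3" "H2 \<in> carrier SU3" "H3 \<in> carrier SU3"
  "H4 \<in> carrier SU3"
  by (simp_all add: SU3_carrier H_mat3 ctrans_mat3 mat3_mult mat3_one mat3_eq_iff det_mat3 cnj_rt
      rt_rt rt_rt_left mult.assoc)

lemma H_distinct: "distinct [mat 1, H0, H1, H2, H3, H4]"
  using rt_nonzero by (simp add: H_mat3 mat3_one mat3_eq_iff)

text \<open>\<open>H1\<close> to \<open>H4\<close> have an entry \<open>rt\<close> or
  \<open>- rt\<close> where \<open>dg\<close> vanishes, and the outer diagonal entries of
  \<open>H0\<close> differ while those of \<open>dg\<close> agree.\<close>

lemma Hset_Em:
  assumes "Em a b c \<in> Hset"
  shows "Em a b c = mat 1"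
  using assms rt_nonzero by (auto simp: Hset_def H_mat3 mat3_one Em_def dg_def mat3_eq_iff)

section \<open>The generators in normal form\<close>

text \<open>Here and below, the \<open>H\<close> factor is the permutation by which the matrix acts
  on the eigenlines; dividing it out leaves a diagonal part, whose eigenvalues give the exponents
  modulo 18.\<close>

lemma G1_eq: "G1 = Em 16 4 16 ** H0"
  unfolding G1_def zeta_cis Em_def dg_def H_mat3 mat3_mult mat3_eq_iff
  by (simp add: zeta_high)

lemma G2_eq: "G2 = Em 16 16 4 ** H2"
  unfolding G2_def zeta_cis Em_def dg_def H_mat3 mat3_mult mat3_eq_iff rt_def[symmetric]
  by (simp add: zeta_high field_simps)

lemma FUM_eq: "FUM = Em 15 15 6"
  unfolding FUM_def Jm_def scale_mat3 zeta_cis Em_def dg_def mat3_eq_iff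
  by (simp add: zeta_high)

lemma Amat_eq: "Amat = Em 8 14 14"
  unfolding Amat_def scale_mat3 zeta_cis Em_def dg_def mat3_eq_iff
  by (simp add: zeta_high field_simps flip: zeta_add)

lemma Bmat_eq: "Bmat = Em 6 12 0"
  unfolding Bmat_def scale_mat3 zeta_cis Em_def dg_def mat3_eq_iff
  by (simp add: zeta_high)

lemma Em_mult_left: "Em a b c ** (Em a' b' c' ** Y) = Em (a + a') (b + b') (c + c') ** Y"
  by (simp add: Em_mult matrix_mul_assoc)

lemma H_Em_left:
  "H0 ** (Em a b c ** Y) = Em c b a ** (H0 ** Y)"
  "H1 ** (Em a b c ** Y) = Em a c b ** (H1 ** Y)"
  "H2 ** (Em a b c ** Y) = Em b a c ** (H2 ** Y)"
  "H3 ** (Em a b c ** Y) = Em c a b ** (H3 ** Y)"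
  "H4 ** (Em a b c ** Y) = Em b c a ** (H4 ** Y)"
  by (simp_all add: H_Em matrix_mul_assoc)

lemma Em_periodic: "18 dvd a \<Longrightarrow> 18 dvd b \<Longrightarrow> 18 dvd c \<Longrightarrow> Em a b c = mat 1"
  by (simp add: Em_eq_1_iff)

text \<open>A rewrite system that sorts a word into one \<open>Em\<close> followed by one
  \<open>H\<close>: products nest to the right, \<open>Em\<close> factors move left and merge, and
  \<open>H\<close> factors multiply by the table.\<close>

lemmas monomial_normalise =
  Em_mult Em_mult_left H_Em H_Em_left H_table matrix_mul_assoc[symmetric] Em_periodic

text \<open>\<open>H0\<close> exchanges the first and third exponents of \<open>G1\<close>, which
  agree; the two factors therefore commute and can be inverted separately.\<close>

lemma matrix_inv_G1: "matrix_inv G1 = Em (- 16) (- 4) (- 16) ** H0"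
  by (rule matrix_inv_unique) (simp add: G1_eq monomial_normalise)

lemma V_eq: "V2 = Em 9 9 0" "V3 = Em 0 9 9" "V4 = Em 9 0 9"
  unfolding V2_def V3_def V4_def matrix_inv_G1
  by (simp_all add: FUM_eq G1_eq monomial_normalise Em_eq_iff)

lemma C_eq: "C18 = Em 17 5 14" "C6 = Em 6 3 9"
  unfolding C18_def C6_def matrix_inv_G1
  by (simp_all add: Amat_eq Bmat_eq FUM_eq G1_eq monomial_normalise Em_eq_iff)

section \<open>Diagonal and monomial subgroups\<close>

text \<open>One family for three subgroups: \<open>Dg 1\<close>, \<open>Dg 2\<close> and
  \<open>Dg 9\<close> turn out to be \<open>NVset\<close>, \<open>Nset\<close> and
  \<open>Vset\<close>. For such divisors of 18 the conditions do not depend on the chosen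
  representatives of the exponents.\<close>

definition Dg :: "int \<Rightarrow> cmat3 set" where
  "Dg m = {Em a b c | a b c. m dvd a \<and> m dvd b \<and> m dvd c \<and> 18 dvd (a + b + c) \<and>
     3 dvd (a - b) \<and> 3 dvd (b - c)}"

text \<open>\<open>Mn 1\<close> and \<open>Mn 2\<close> turn out to be \<open>Fr648\<close> and
  \<open>Fr162\<close>.\<close>

definition Mn :: "int \<Rightarrow> cmat3 set" where
  "Mn m = {D ** H | D H. D \<in> Dg m \<and> H \<in> Hset}"

lemma DgI:
  assumes "m dvd a" "m dvd b" "m dvd c" "18 dvd (a + b + c)" "3 dvd (a - b)" "3 dvd (b - c)"
  shows "Em a b c \<in> Dg m"
  using assms unfolding Dg_def by blast

lemma DgE:
  assumes "D \<in> Dg m"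
  obtains a b c where "D = Em a b c" "m dvd a" "m dvd b" "m dvd c" "18 dvd (a + b + c)"
    "3 dvd (a - b)" "3 dvd (b - c)"
  using assms unfolding Dg_def by blast

lemma MnI: "D \<in> Dg m \<Longrightarrow> H \<in> Hset \<Longrightarrow> D ** H \<in> Mn m"
  unfolding Mn_def by blast

lemma inv_Em:
  assumes "18 dvd (a + b + c)"
  shows "inv\<^bsub>SU3\<^esub> (Em a b c) = Em (- a) (- b) (- c)"
proof (rule inv_SU3_unique)
  show "Em (- a) (- b) (- c) \<in> carrier SU3"
    using assms dvd_minus_iff[of 18 "a + b + c"] by (simp add: Em_in_SU3 algebra_simps)
qed (use assms in \<open>simp_all add: Em_in_SU3 Em_mult Em_0\<close>)

lemma subgroup_Dg: "subgroup (Dg m) SU3"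
proof (rule SU3.subgroupI)
  show "Dg m \<subseteq> carrier SU3"
    by (auto simp: Dg_def Em_in_SU3)
  show "Dg m \<noteq> {}"
    using DgI[of m 0 0 0] by auto
  fix x assume "x \<in> Dg m"
  then obtain a b c where x: "x = Em a b c" "m dvd a" "m dvd b" "m dvd c" "18 dvd (a + b + c)"
    "3 dvd (a - b)" "3 dvd (b - c)"
    by (rule DgE)
  have "18 dvd (- a + - b + - c)" "3 dvd (- a - - b)" "3 dvd (- b - - c)"
    using x(5-) dvd_minus_iff[of 18 "a + b + c"] dvd_minus_iff[of 3 "a - b"]
      dvd_minus_iff[of 3 "b - c"] by (simp_all add: algebra_simps)
  with x show "inv\<^bsub>SU3\<^esub> x \<in> Dg m"
    by (simp add: inv_Em DgI)
  fix y assume "y \<in> Dg m"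
  then obtain a' b' c' where y: "y = Em a' b' c'" "m dvd a'" "m dvd b'" "m dvd c'"
    "18 dvd (a' + b' + c')" "3 dvd (a' - b')" "3 dvd (b' - c')"
    by (rule DgE)
  have "18 dvd (a + a' + (b + b') + (c + c'))" "3 dvd (a + a' - (b + b'))" "3 dvd (b + b' - (c + c'))"
    using dvd_add[OF x(5) y(5)] dvd_add[OF x(6) y(6)] dvd_add[OF x(7) y(7)]
    by (simp_all add: algebra_simps)
  with x y show "x \<otimes>\<^bsub>SU3\<^esub> y \<in> Dg m"
    by (simp add: Em_mult DgI)
qed

lemma subgroup_Hset: "subgroup Hset SU3"
proof (rule SU3.subgroupI)
  have one: "mat 1 \<in> carrier SU3"
    using SU3.one_closed by simp
  then show "Hset \<subseteq> carrier SU3"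
    by (auto simp: Hset_def H_in_SU3)
  fix x assume x: "x \<in> Hset"
  have "inv\<^bsub>SU3\<^esub> (mat 1) = mat 1" "inv\<^bsub>SU3\<^esub> H0 = H0" "inv\<^bsub>SU3\<^esub> H1 = H1" "inv\<^bsub>SU3\<^esub> H2 = H2"
    "inv\<^bsub>SU3\<^esub> H3 = H4" "inv\<^bsub>SU3\<^esub> H4 = H3"
    by (simp_all add: inv_SU3_unique one H_in_SU3 H_table)
  with x show "inv\<^bsub>SU3\<^esub> x \<in> Hset"
    by (auto simp: Hset_def)
  fix y assume "y \<in> Hset"
  with x show "x \<otimes>\<^bsub>SU3\<^esub> y \<in> Hset"
    by (auto simp: Hset_def H_table)
qed (simp add: Hset_def)

text \<open>The conditions defining \<open>Dg m\<close> are symmetric in the three exponents, so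
  each of the six permutations preserves them.\<close>

lemma H_Dg:
  assumes "H \<in> Hset" "D \<in> Dg m"
  shows "\<exists>D'\<in>Dg m. H ** D = D' ** H"
proof -
  obtain a b c where D: "D = Em a b c" "m dvd a" "m dvd b" "m dvd c" "18 dvd (a + b + c)"
    "3 dvd (a - b)" "3 dvd (b - c)"
    using assms(2) by (rule DgE)
  have "18 dvd (c + b + a)" "18 dvd (a + c + b)" "18 dvd (b + a + c)" "18 dvd (c + a + b)"
    "18 dvd (b + c + a)"
    using D(5) by (simp_all add: ac_simps)
  moreover have "3 dvd (a - c)"
    using dvd_add[OF D(6,7)] by simp
  moreover from this have "3 dvd (b - a)" "3 dvd (c - b)" "3 dvd (c - a)"
    using D(6,7) by (simp_all add: dvd_diff_commute)
  ultimately have "Em a b c \<in> Dg m" "Em c b a \<in> Dg m" "Em a c b \<in> Dg m" "Em b a c \<in> Dg m" "Em c a b \<in> Dg m"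
    "Em b c a \<in> Dg m"
    using D by (blast intro: DgI)+
  moreover have "\<exists>x\<in>{(a, b, c), (c, b, a), (a, c, b), (b, a, c), (c, a, b), (b, c, a)}.
      H ** D = (case x of (x, y, z) \<Rightarrow> Em x y z) ** H"
    using assms(1) by (auto simp: D(1) Hset_def H_Em)
  ultimately show ?thesis by fastforce
qed

text \<open>Since \<open>Hset\<close> normalises \<open>Dg m\<close>, products and inverses can be
  sorted again into a diagonal part followed by an element of \<open>Hset\<close>.\<close>

lemma subgroup_Mn: "subgroup (Mn m) SU3"
proof (rule SU3.subgroupI)
  note Dg = subgroup.subset[OF subgroup_Dg[of m], THEN subsetD]
    subgroup.m_closed[OF subgroup_Dg[of m], simplified] subgroup.m_inv_closed[OF subgroup_Dg[of m]]
  note H = subgroup.subset[OF subgroup_Hset, THEN subsetD]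
    subgroup.m_closed[OF subgroup_Hset, simplified] subgroup.m_inv_closed[OF subgroup_Hset]
  show "Mn m \<subseteq> carrier SU3"
  proof
    fix x assume "x \<in> Mn m"
    then obtain D H where "x = D ** H" "D \<in> Dg m" "H \<in> Hset"
      unfolding Mn_def by blast
    then show "x \<in> carrier SU3"
      using SU3.m_closed[OF Dg(1) H(1), of D H] by simp
  qed
  show "Mn m \<noteq> {}"
    using MnI[OF DgI[of m 0 0 0], of H1] by (auto simp: Hset_def)
  fix x assume "x \<in> Mn m"
  then obtain D H where x: "x = D ** H" "D \<in> Dg m" "H \<in> Hset"
    unfolding Mn_def by blast
  have "inv\<^bsub>SU3\<^esub> x = inv\<^bsub>SU3\<^esub> H ** inv\<^bsub>SU3\<^esub> D"
    using SU3.inv_mult_group[of D H] x Dg(1) H(1) by simp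
  moreover obtain D' where "D' \<in> Dg m" "inv\<^bsub>SU3\<^esub> H ** inv\<^bsub>SU3\<^esub> D = D' ** inv\<^bsub>SU3\<^esub> H"
    using H_Dg[OF H(3)[OF x(3)] Dg(3)[OF x(2)]] by blast
  ultimately show "inv\<^bsub>SU3\<^esub> x \<in> Mn m"
    using MnI[OF _ H(3)[OF x(3)]] by simp
  fix y assume "y \<in> Mn m"
  then obtain E K where y: "y = E ** K" "E \<in> Dg m" "K \<in> Hset"
    unfolding Mn_def by blast
  obtain E' where E': "E' \<in> Dg m" "H ** E = E' ** H"
    using H_Dg[OF x(3) y(2)] by blast
  have "x ** y = D ** (H ** E) ** K"
    by (simp only: x(1) y(1) matrix_mul_assoc)
  also have "\<dots> = (D ** E') ** (H ** K)"
    by (simp only: E'(2) matrix_mul_assoc)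
  finally show "x \<otimes>\<^bsub>SU3\<^esub> y \<in> Mn m"
    using MnI[OF Dg(2)[OF x(2) E'(1)] H(2)[OF x(3) y(3)]] by simp
qed

lemma Dg_Int_Hset: "Dg m \<inter> Hset = {mat 1}"
proof -
  have "mat 1 \<in> Dg m" "mat 1 \<in> Hset"
    using subgroup.one_closed[OF subgroup_Dg] subgroup.one_closed[OF subgroup_Hset] by simp_all
  moreover have "x = mat 1" if "x \<in> Dg m" "x \<in> Hset" for x
    using that Hset_Em by (metis DgE)
  ultimately show ?thesis by blast
qed

lemma Dg_Hset_cancel:
  assumes "D ** H = D' ** H'" "D \<in> Dg m" "D' \<in> Dg m" "H \<in> Hset" "H' \<in> Hset"
  shows "D = D' \<and> H = H'"
proof -
  interpret group_disjoint_sum SU3 "Dg m" Hset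
    by (intro group_disjoint_sum.intro group_SU3 subgroup_Dg subgroup_Hset)
  show ?thesis
    using cancel Dg_Int_Hset assms by simp
qed

section \<open>Generation\<close>

lemma Em_pow: "Em a b c [^]\<^bsub>SU3\<^esub> n = Em (int n * a) (int n * b) (int n * c)"
  by (induction n) (simp_all add: Em_0 Em_mult algebra_simps)

lemma Em_multiple_in_subgroup:
  assumes "subgroup S SU3" "Em a b c \<in> S"
  shows "Em (k * a) (k * b) (k * c) \<in> S"
proof -
  \<comment> \<open>Exponents matter only modulo 18, so even a negative multiple is a power with a
    natural exponent.\<close>
  define n where "n = nat (k mod 18)"
  have "Em a b c [^]\<^bsub>SU3\<^esub> n \<in> S"
    using assms by (induction n) (simp_all add: subgroup.one_closed subgroup.m_closed
        subgroup.one_closed[of S SU3, simplified] subgroup.m_closed[of S SU3, simplified])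
  moreover have "18 dvd (int n - k)"
    by (simp add: n_def mod_eq_dvd_iff[symmetric])
  then have "18 dvd (int n * x - k * x)" for x
    by (metis dvd_mult2 left_diff_distrib)
  then have "Em a b c [^]\<^bsub>SU3\<^esub> n = Em (k * a) (k * b) (k * c)"
    by (simp add: Em_pow Em_eq_iff)
  ultimately show ?thesis by simp
qed

lemma Em_combination_in_subgroup:
  assumes "subgroup S SU3" "Em a b c \<in> S" "Em a' b' c' \<in> S"
  shows "Em (i * a + j * a') (i * b + j * b') (i * c + j * c') \<in> S"
  using subgroup.m_closed[OF assms(1) Em_multiple_in_subgroup[OF assms(1,2), of i]
      Em_multiple_in_subgroup[OF assms(1,3), of j]]
  by (simp add: Em_mult)

lemma Dg_2_eq:
  assumes "2 dvd a" "2 dvd b" "2 dvd c" "18 dvd (a + b + c)" "3 dvd (a - b)" "3 dvd (b - c)"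
  shows "\<exists>i j. Em a b c = Em (i * 8 + j * 6) (i * 14 + j * 12) (i * 14 + j * 0)"
proof -
  obtain k m where km: "a = 2 * k" "c = 2 * m"
    using assms(1,3) by (auto elim!: dvdE)
  obtain t where t: "a - c = 3 * t"
    using dvd_add[OF assms(5,6)] by (auto elim!: dvdE)
  then have "even (3 * t)"
    unfolding km by (metis dvd_triv_left right_diff_distrib)
  then obtain u where u: "t = 2 * u"
    by (auto elim!: evenE)
  obtain n where n: "a + b + c = 18 * n"
    using assms(4) ..
  \<comment> \<open>The coefficient of \<open>Amat\<close> is \<open>2 * c\<close>: the third
    exponent asks for 14 i = c modulo 18, and with c = 2 m the inverse 4 of 7 modulo 9 gives i = 4
    m. The first exponent then asks for 6 j = a + 2 c = (a - c) + 3 c = 6 (u + m), and the second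
    follows from the sum.\<close>
  define j where "j = u + m"
  have "a = 6 * j - 2 * c" "b = 18 * n - a - c"
    using t u km n by (simp_all add: j_def)
  then have "a - (2 * c * 8 + j * 6) = 18 * (- c)"
    "b - (2 * c * 14 + j * 12) = 18 * (n - j - 3 * m)"
    "c - (2 * c * 14 + j * 0) = 18 * (- 3 * m)"
    by (simp_all add: km)
  then have "Em a b c = Em (2 * c * 8 + j * 6) (2 * c * 14 + j * 12) (2 * c * 14 + j * 0)"
    unfolding Em_eq_iff by (metis dvd_triv_left)
  then show ?thesis by blast
qed

lemma Dg_2_subset:
  assumes "subgroup S SU3" "Amat \<in> S" "Bmat \<in> S"
  shows "Dg 2 \<subseteq> S"
  using Em_combination_in_subgroup[OF assms[unfolded Amat_eq Bmat_eq]] Dg_2_eq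
  by (metis DgE subsetI)

lemma Dg_1_eq:
  assumes "18 dvd (a + b + c)" "3 dvd (a - b)" "3 dvd (b - c)"
  shows "\<exists>i j. Em a b c = Em (i * 17 + j * 6) (i * 5 + j * 3) (i * 14 + j * 9)"
proof -
  obtain k where k: "a - b = 3 * k"
    using assms(2) ..
  obtain n where n: "a + b + c = 18 * n"
    using assms(1) ..
  \<comment> \<open>As 17 = -1 modulo 18, the first exponent forces i = 6 j - a. The second then
    reads -3 j = 6 a - 3 k modulo 18, solved by this \<open>j\<close>; the third follows from the
    sum.\<close>
  define j where "j = k - 2 * a"
  define i where "i = 6 * j - a"
  have "b = a - 3 * k" "c = 18 * n - a - b"
    using k n by simp_all
  then have "a - (i * 17 + j * 6) = 18 * (13 * a - 6 * k)"
    "b - (i * 5 + j * 3) = 18 * (4 * a - 2 * k)"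
    "c - (i * 14 + j * 9) = 18 * (n + 11 * a - 5 * k)"
    by (simp_all add: i_def j_def algebra_simps)
  then have "Em a b c = Em (i * 17 + j * 6) (i * 5 + j * 3) (i * 14 + j * 9)"
    unfolding Em_eq_iff by (metis dvd_triv_left)
  then show ?thesis by blast
qed

lemma Mn_subset:
  assumes "subgroup S SU3" "Dg m \<subseteq> S" "H1 \<in> S" "H3 \<in> S"
  shows "Mn m \<subseteq> S"
proof -
  note mult = subgroup.m_closed[OF assms(1), simplified]
  have "H0 \<in> S" "H2 \<in> S" "H4 \<in> S" "mat 1 \<in> S"
    using mult[OF assms(3,4)] mult[OF assms(4,3)] mult[OF assms(4,4)] mult[OF assms(3,3)]
    by (simp_all add: H_table)
  with assms have "Hset \<subseteq> S"
    by (simp add: Hset_def)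
  with assms(2) mult show ?thesis
    unfolding Mn_def by blast
qed

lemma Dg_1_subset:
  assumes "subgroup S SU3" "C18 \<in> S" "C6 \<in> S"
  shows "Dg 1 \<subseteq> S"
  using Em_combination_in_subgroup[OF assms[unfolded C_eq]] Dg_1_eq
  by (metis DgE subsetI)

section \<open>The generated groups as groups of monomial matrices\<close>

lemma generators_in_Mn: "G1 \<in> Mn 2" "G2 \<in> Mn 2" "FUM \<in> Mn 1" "C18 \<in> Mn 1" "C6 \<in> Mn 1"
  "H1 \<in> Mn m" "H3 \<in> Mn m"
proof -
  have mem: "Em a b c \<in> Mn m" if "Em a b c \<in> Dg m" for a b c m
    using MnI[OF that, of "mat 1"] by (simp add: Hset_def)
  show "FUM \<in> Mn 1" "C18 \<in> Mn 1" "C6 \<in> Mn 1"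
    by (auto simp: FUM_eq C_eq intro!: mem DgI)
  have "H \<in> Mn m" if "H \<in> Hset" for H m
    using MnI[OF DgI[of m 0 0 0] that] by (simp add: Em_0)
  then show "H1 \<in> Mn m" "H3 \<in> Mn m"
    by (simp_all add: Hset_def)
qed (auto simp: G1_eq G2_eq Hset_def intro!: MnI DgI)

lemma Mn_mono: "m dvd n \<Longrightarrow> Mn n \<subseteq> Mn m"
  unfolding Mn_def Dg_def by (smt (verit) Collect_mono dvd_trans mem_Collect_eq)

text \<open>Only positive words occur, so closure under multiplication suffices to use them. The
  block of seventeen factors is the inverse of \<open>G1\<close>, which has order 18.\<close>

lemma generators_as_words:
  "H1 = G1 ** G2 ** G1"
  "H3 = G1 ** G1 ** G1 ** G1 ** G1 ** G1 ** G1 ** G2 ** G1 ** G1 ** G1 ** G1"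
  "Amat = G1 ** G1 ** G2 ** G1 ** G1 ** G1 ** G1 ** G2"
  "Bmat = G1 ** G1 ** G1 ** G1 ** G2 ** G2"
  "C18 = Amat ** (FUM ** FUM ** FUM)"
  "C6 = Bmat ** (G1 ** (FUM ** FUM ** FUM) ** (G1 ** G1 ** G1 ** G1 ** G1 ** G1 ** G1 ** G1 ** G1 **
     G1 ** G1 ** G1 ** G1 ** G1 ** G1 ** G1 ** G1))"
  by (simp_all add: C_eq Amat_eq Bmat_eq G1_eq G2_eq FUM_eq monomial_normalise Em_eq_iff)

text \<open>\<open>G1\<close> and \<open>G2\<close> have even exponents, which gives one inclusion;
  conversely \<open>Amat\<close> and \<open>Bmat\<close> span \<open>Dg 2\<close>, \<open>H1\<close>
  and \<open>H3\<close> generate \<open>Hset\<close>, and all four are words in \<open>G1\<close>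
  and \<open>G2\<close>.\<close>

lemma Fr162_eq: "Fr162 = Mn 2"
proof
  show "Fr162 \<subseteq> Mn 2"
    unfolding Fr162_def
    by (rule SU3.generate_subgroup_incl) (simp_all add: generators_in_Mn subgroup_Mn)
  have sub: "{G1, G2} \<subseteq> carrier SU3"
    using subgroup.subset[OF subgroup_Mn] generators_in_Mn by blast
  have S: "subgroup Fr162 SU3"
    unfolding Fr162_def by (rule SU3.generate_is_subgroup[OF sub])
  have "G1 \<in> Fr162" "G2 \<in> Fr162"
    unfolding Fr162_def by (auto intro: generate.incl)
  note mem = this subgroup.m_closed[OF S, simplified]
  have "Amat \<in> Fr162" "Bmat \<in> Fr162" "H1 \<in> Fr162" "H3 \<in> Fr162"
    unfolding generators_as_words(1-4) by (intro mem)+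
  with S show "Mn 2 \<subseteq> Fr162"
    by (intro Mn_subset Dg_2_subset)
qed

lemma Fr648_eq: "Fr648 = Mn 1"
proof
  have gens: "{G1, G2, FUM} \<subseteq> Mn 1"
    using generators_in_Mn Mn_mono[of 1 2] by auto
  then show "Fr648 \<subseteq> Mn 1"
    unfolding Fr648_def by (rule SU3.generate_subgroup_incl) (rule subgroup_Mn)
  have sub: "{G1, G2, FUM} \<subseteq> carrier SU3"
    using subgroup.subset[OF subgroup_Mn] gens by blast
  have S: "subgroup Fr648 SU3"
    unfolding Fr648_def by (rule SU3.generate_is_subgroup[OF sub])
  have "G1 \<in> Fr648" "G2 \<in> Fr648" "FUM \<in> Fr648"
    unfolding Fr648_def by (auto intro: generate.incl)
  note mem = this subgroup.m_closed[OF S, simplified]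
  have "Amat \<in> Fr648" "Bmat \<in> Fr648" "H1 \<in> Fr648" "H3 \<in> Fr648"
    unfolding generators_as_words(1-4) by (intro mem)+
  moreover from this have "C18 \<in> Fr648" "C6 \<in> Fr648"
    unfolding generators_as_words(5,6) by (auto intro!: mem)
  ultimately show "Mn 1 \<subseteq> Fr648"
    using S by (intro Mn_subset Dg_1_subset)
qed

lemma generate_C_H: "generate SU3 {C6, C18, H1, H3} = Fr648"
  unfolding Fr648_eq
proof
  have gens: "{C6, C18, H1, H3} \<subseteq> Mn 1"
    using generators_in_Mn by auto
  then show "generate SU3 {C6, C18, H1, H3} \<subseteq> Mn 1"
    by (rule SU3.generate_subgroup_incl) (rule subgroup_Mn)
  have "{C6, C18, H1, H3} \<subseteq> carrier SU3"
    using subgroup.subset[OF subgroup_Mn] gens by blast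
  then show "Mn 1 \<subseteq> generate SU3 {C6, C18, H1, H3}"
    by (intro Mn_subset Dg_1_subset SU3.generate_is_subgroup) (auto intro: generate.incl)
qed

lemma Nset_eq: "Nset = Dg 2"
proof
  have gens: "{Amat, Bmat} \<subseteq> Dg 2"
    by (auto simp: Amat_eq Bmat_eq intro!: DgI)
  then show "Nset \<subseteq> Dg 2"
    unfolding Nset_def by (rule SU3.generate_subgroup_incl) (rule subgroup_Dg)
  have "{Amat, Bmat} \<subseteq> carrier SU3"
    using subgroup.subset[OF subgroup_Dg] gens by blast
  then show "Dg 2 \<subseteq> Nset"
    unfolding Nset_def
    by (intro Dg_2_subset SU3.generate_is_subgroup) (auto intro: generate.incl)
qed

section \<open>The abelian normal subgroup\<close>

text \<open>The product of the \<open>i\<close>-th power of \<open>C18\<close> and the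
  \<open>j\<close>-th power of \<open>C6\<close>, for arbitrary integers.\<close>

definition Cm :: "int \<Rightarrow> int \<Rightarrow> cmat3" where
  "Cm i j = Em (i * 17 + j * 6) (i * 5 + j * 3) (i * 14 + j * 9)"

lemma Cm_mult: "Cm i j ** Cm i' j' = Cm (i + i') (j + j')"
  by (simp add: Cm_def Em_mult algebra_simps)

lemma Cm_eq_1_iff: "Cm i j = mat 1 \<longleftrightarrow> 18 dvd i \<and> 6 dvd j"
proof
  assume "Cm i j = mat 1"
  then have dvd: "18 dvd (i * 17 + j * 6)" "18 dvd (i * 5 + j * 3)"
    by (simp_all add: Cm_def Em_eq_1_iff)
  \<comment> \<open>This combination eliminates \<open>j\<close> and leaves 7 i, where 7 is a unit
    modulo 18.\<close>
  then have "18 dvd (i * 17 + j * 6 - 2 * (i * 5 + j * 3))"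
    by (metis dvd_diff dvd_mult)
  moreover have "i * 17 + j * 6 - 2 * (i * 5 + j * 3) = 7 * i"
    by simp
  ultimately have i: "18 dvd i"
    by presburger
  then have "18 dvd (i * 5 + j * 3 - i * 5)"
    using dvd(2) by (metis dvd_diff dvd_mult2)
  moreover have "i * 5 + j * 3 - i * 5 = 3 * j"
    by simp
  ultimately have "6 dvd j"
    by presburger
  with i show "18 dvd i \<and> 6 dvd j" ..
next
  assume "18 dvd i \<and> 6 dvd j"
  then obtain k l where kl: "i = 18 * k" "j = 6 * l"
    by (auto elim!: dvdE)
  have "Cm i j = Em (18 * (17 * k + 2 * l)) (18 * (5 * k + l)) (18 * (14 * k + 3 * l))"
    unfolding Cm_def kl by (simp add: algebra_simps)
  then show "Cm i j = mat 1"
    by (simp add: Em_eq_1_iff)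
qed

lemma Cm_eq_iff: "Cm i j = Cm i' j' \<longleftrightarrow> 18 dvd (i - i') \<and> 6 dvd (j - j')"
proof -
  have "Cm (i - i') (j - j') = Cm i j ** Cm (- i') (- j')"
    "Cm i j = Cm (i - i') (j - j') ** Cm i' j'" "Cm i' j' ** Cm (- i') (- j') = mat 1"
    by (simp_all add: Cm_mult Cm_eq_1_iff)
  then have "Cm i j = Cm i' j' \<longleftrightarrow> Cm (i - i') (j - j') = mat 1"
    by (metis matrix_mul_lid)
  then show ?thesis
    unfolding Cm_eq_1_iff .
qed

text \<open>The index range is the carrier of Z/18 x Z/6, so this serves both for counting
  \<open>Dg 1\<close> and for the isomorphism with that product.\<close>

lemma Cm_bij: "bij_betw (\<lambda>(i, j). Cm i j) ({0..<18} \<times> {0..<6}) (Dg 1)"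
proof (rule bij_betw_imageI)
  show "inj_on (\<lambda>(i, j). Cm i j) ({0..<18} \<times> {0..<6})"
  proof (rule inj_onI)
    fix x y :: "int \<times> int"
    assume xy: "x \<in> {0..<18} \<times> {0..<6}" "y \<in> {0..<18} \<times> {0..<6}"
      "(case x of (i, j) \<Rightarrow> Cm i j) = (case y of (i, j) \<Rightarrow> Cm i j)"
    obtain i j i' j' where eq: "x = (i, j)" "y = (i', j')"
      by (cases x, cases y)
    have "i mod 18 = i' mod 18" "j mod 6 = j' mod 6"
      using xy(3) by (simp_all only: eq prod.case Cm_eq_iff mod_eq_dvd_iff)
    moreover have "i mod 18 = i" "i' mod 18 = i'" "j mod 6 = j" "j' mod 6 = j'"
      using xy(1,2) by (simp_all add: eq mod_pos_pos_trivial)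
    ultimately show "x = y"
      by (simp add: eq)
  qed
  have "Cm i j \<in> Dg 1" for i j
    using Em_combination_in_subgroup[OF subgroup_Dg DgI DgI, of 1 17 5 14 6 3 9 i j]
    by (simp add: Cm_def)
  moreover have "D \<in> (\<lambda>(i, j). Cm i j) ` ({0..<18} \<times> {0..<6})" if D: "D \<in> Dg 1" for D
  proof -
    obtain a b c where "D = Em a b c" "18 dvd (a + b + c)" "3 dvd (a - b)" "3 dvd (b - c)"
      using D by (rule DgE)
    then obtain i j where "D = Cm i j"
      using Dg_1_eq[of a b c] unfolding Cm_def by blast
    moreover have "18 dvd (i - i mod 18)" "6 dvd (j - j mod 6)"
      by (simp_all flip: mod_eq_dvd_iff)
    ultimately have "D = (\<lambda>(i, j). Cm i j) (i mod 18, j mod 6)"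
      by (simp add: Cm_eq_iff)
    then show ?thesis
      by (rule image_eqI) simp
  qed
  ultimately show "(\<lambda>(i, j). Cm i j) ` ({0..<18} \<times> {0..<6}) = Dg 1"
    by (intro equalityI image_subsetI subsetI) (simp_all add: case_prod_beta)
qed

section \<open>The order of the full group\<close>

lemma card_Hset: "finite Hset \<and> card Hset = 6"
proof -
  have eq: "Hset = set [mat 1, H0, H1, H2, H3, H4]"
    by (simp add: Hset_def)
  show ?thesis
    unfolding eq distinct_card[OF H_distinct] by simp
qed

lemma card_Fr648: "finite Fr648 \<and> card Fr648 = 648"
proof -
  have "card (Dg 1) = 108" "finite (Dg 1)"
    using bij_betw_same_card[OF Cm_bij] bij_betw_finite[OF Cm_bij]
    by (simp_all add: card_cartesian_product)
  then have "card (Dg 1 \<times> Hset) = 648" "finite (Dg 1 \<times> Hset)"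
    using card_Hset by (simp_all add: card_cartesian_product)
  moreover have "bij_betw (\<lambda>(D, H). D ** H) (Dg 1 \<times> Hset) (Mn 1)"
  proof (rule bij_betw_imageI)
    show "inj_on (\<lambda>(D, H). D ** H) (Dg 1 \<times> Hset)"
    proof (rule inj_onI)
      fix x y assume xy: "x \<in> Dg 1 \<times> Hset" "y \<in> Dg 1 \<times> Hset"
        "(case x of (D, H) \<Rightarrow> D ** H) = (case y of (D, H) \<Rightarrow> D ** H)"
      obtain D H D' H' where eq: "x = (D, H)" "y = (D', H')"
        by (cases x, cases y)
      show "x = y"
        using Dg_Hset_cancel[of D H D' H' 1] xy by (simp add: eq)
    qed
    show "(\<lambda>(D, H). D ** H) ` (Dg 1 \<times> Hset) = Mn 1"
      unfolding Mn_def by (simp add: image_def) blast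
  qed
  ultimately show ?thesis
    unfolding Fr648_eq
    using bij_betw_same_card[of _ "Dg 1 \<times> Hset" "Mn 1"] bij_betw_finite[of _ "Dg 1 \<times> Hset" "Mn 1"]
    by metis
qed

section \<open>The Klein four-group and the splitting of the abelian part\<close>

lemma Vset_eq: "Vset = Dg 9"
proof
  show "Vset \<subseteq> Dg 9"
    using subgroup.one_closed[OF subgroup_Dg] by (auto simp: Vset_def V_eq intro!: DgI)
  show "Dg 9 \<subseteq> Vset"
  proof
    fix D assume "D \<in> Dg 9"
    then obtain a b c where D: "D = Em a b c" "9 dvd a" "9 dvd b" "9 dvd c" "18 dvd (a + b + c)"
      by (rule DgE)
    then obtain i j k where ijk: "a = 9 * i" "b = 9 * j" "c = 9 * k"
      by (auto elim!: dvdE)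
    obtain s where "a + b + c = 18 * s"
      using D(5) ..
    then have "i + j + k = 2 * s"
      by (simp add: ijk)
    then have "2 dvd (i + j + k)"
      by simp
    \<comment> \<open>Modulo 18 a multiple of nine is 0 or 9 according to the parity of its
      quotient, and the even sum permits none or exactly two nines.\<close>
    then consider "even i" "even j" "even k" | "even i" "odd j" "odd k" | "odd i" "even j" "odd k" |
      "odd i" "odd j" "even k"
      by fastforce
    moreover have nine: "18 dvd (9 * x - 0) \<longleftrightarrow> even x" "18 dvd (9 * x - 9) \<longleftrightarrow> odd x" for x :: int
      by presburger+
    ultimately have "D = Em 0 0 0 \<or> D = Em 0 9 9 \<or> D = Em 9 0 9 \<or> D = Em 9 9 0"
      unfolding D(1) ijk Em_eq_iff by cases (simp_all add: nine)
    then show "D \<in> Vset"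
      by (auto simp: Vset_def V_eq Em_0)
  qed
qed

text \<open>The even and the nine-divisible representatives of an exponent agree modulo 18, so both
  are divisible by 2 and by 9, hence by 18.\<close>

lemma Dg_2_Int_Dg_9: "Dg 2 \<inter> Dg 9 = {mat 1}"
proof -
  have "mat 1 \<in> Dg m" for m
    using subgroup.one_closed[OF subgroup_Dg] by simp
  moreover have "x = mat 1" if x: "x \<in> Dg 2" "x \<in> Dg 9" for x
  proof -
    obtain a b c where x2: "x = Em a b c" "2 dvd a" "2 dvd b" "2 dvd c"
      using x(1) by (rule DgE)
    obtain a' b' c' where x9: "x = Em a' b' c'" "9 dvd a'" "9 dvd b'" "9 dvd c'"
      using x(2) by (rule DgE)
    have "18 dvd (a - a')" "18 dvd (b - b')" "18 dvd (c - c')"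
      using x2(1) x9(1) Em_eq_iff by metis+
    moreover have "18 dvd x" if xy: "18 dvd (x - y)" "2 dvd x" "9 dvd y" for x y :: int
    proof -
      obtain u v w where uvw: "x - y = 18 * u" "x = 2 * v" "y = 9 * w"
        using xy by (auto elim!: dvdE)
      then have "even (9 * w)"
        by presburger
      then have "even w" by simp
      then show ?thesis
        using uvw by presburger
    qed
    ultimately have "18 dvd a" "18 dvd b" "18 dvd c"
      using x2(2-4) x9(2-4) by blast+
    then show ?thesis
      by (simp add: x2(1) Em_eq_1_iff)
  qed
  ultimately show ?thesis by blast
qed

lemma Dg_2_Dg_9_cancel:
  assumes "D ** H = D' ** H'" "D \<in> Dg 2" "D' \<in> Dg 2" "H \<in> Dg 9" "H' \<in> Dg 9"
  shows "D = D' \<and> H = H'"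
proof -
  interpret group_disjoint_sum SU3 "Dg 2" "Dg 9"
    by (intro group_disjoint_sum.intro group_SU3 subgroup_Dg)
  show ?thesis
    using cancel Dg_2_Int_Dg_9 assms by simp
qed

lemma Dg_mono: "m dvd n \<Longrightarrow> Dg n \<subseteq> Dg m"
  by (smt (verit, best) DgE DgI dvd_trans subsetI)

lemma Em_scaled_in_Dg:
  assumes "m dvd k" "18 dvd (a + b + c)" "3 dvd (a - b)" "3 dvd (b - c)"
  shows "Em (k * a) (k * b) (k * c) \<in> Dg m"
proof (rule DgI)
  show "18 dvd (k * a + k * b + k * c)" "3 dvd (k * a - k * b)" "3 dvd (k * b - k * c)"
    using assms(2-4)[THEN dvd_mult, of k] by (simp_all only: distrib_left right_diff_distrib)
qed (use assms(1) in simp_all)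

lemma NVset_eq: "NVset = Dg 1"
proof
  show "NVset \<subseteq> Dg 1"
    using Dg_mono[of 1 2] Dg_mono[of 1 9] subgroup.m_closed[OF subgroup_Dg[of 1]]
    unfolding NVset_def Nset_eq Vset_eq by auto
  show "Dg 1 \<subseteq> NVset"
  proof
    fix D assume "D \<in> Dg 1"
    then obtain a b c where D: "D = Em a b c" "18 dvd (a + b + c)" "3 dvd (a - b)" "3 dvd (b - c)"
      by (rule DgE)
    \<comment> \<open>The splitting 1 = 10 - 9 into an even number and a multiple of nine.\<close>
    have "Em (10 * a) (10 * b) (10 * c) \<in> Dg 2" "Em (- 9 * a) (- 9 * b) (- 9 * c) \<in> Dg 9"
      using Em_scaled_in_Dg[OF _ D(2-), of 2 10] Em_scaled_in_Dg[OF _ D(2-), of 9 "- 9"]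
      by simp_all
    moreover have "D = Em (10 * a) (10 * b) (10 * c) ** Em (- 9 * a) (- 9 * b) (- 9 * c)"
      by (simp add: D(1) Em_mult)
    ultimately show "D \<in> NVset"
      unfolding NVset_def Nset_eq Vset_eq by blast
  qed
qed

lemma Dg_commute: "x \<in> Dg m \<Longrightarrow> y \<in> Dg n \<Longrightarrow> x ** y = y ** x"
  by (auto elim!: DgE simp: Em_mult add.commute)

lemma NVset_iso_product:
  "SU3\<lparr>carrier := NVset\<rparr> \<cong> DirProd (SU3\<lparr>carrier := Nset\<rparr>) (SU3\<lparr>carrier := Vset\<rparr>)"
proof -
  let ?P = "DirProd (SU3\<lparr>carrier := Nset\<rparr>) (SU3\<lparr>carrier := Vset\<rparr>)"
  have "group ?P"
    by (intro DirProd_group SU3.subgroup_imp_group) (simp_all add: Nset_eq Vset_eq subgroup_Dg)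
  moreover have "(\<lambda>(N, T). N ** T) \<in> iso ?P (SU3\<lparr>carrier := NVset\<rparr>)"
  proof (rule isoI)
    show "(\<lambda>(N, T). N ** T) \<in> hom ?P (SU3\<lparr>carrier := NVset\<rparr>)"
    proof (rule homI)
      fix x y assume "x \<in> carrier ?P" "y \<in> carrier ?P"
      then obtain N T N' T' where xy: "x = (N, T)" "y = (N', T')" "T \<in> Dg 9" "N' \<in> Dg 2"
        by (auto simp: Nset_eq Vset_eq)
      have "(N ** N') ** (T ** T') = N ** (N' ** T) ** T'"
        by (simp add: matrix_mul_assoc)
      also have "\<dots> = (N ** T) ** (N' ** T')"
        by (simp only: Dg_commute[OF xy(4,3)] matrix_mul_assoc)
      finally show "(case x \<otimes>\<^bsub>?P\<^esub> y of (N, T) \<Rightarrow> N ** T) = (case x of (N, T) \<Rightarrow> N ** T)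
          \<otimes>\<^bsub>SU3\<lparr>carrier := NVset\<rparr>\<^esub> (case y of (N, T) \<Rightarrow> N ** T)"
        by (simp add: xy)
    qed (auto simp: NVset_def)
    show "bij_betw (\<lambda>(N, T). N ** T) (carrier ?P) (carrier (SU3\<lparr>carrier := NVset\<rparr>))"
    proof (rule bij_betw_imageI)
      show "inj_on (\<lambda>(N, T). N ** T) (carrier ?P)"
      proof (rule inj_onI)
        fix x y assume xy: "x \<in> carrier ?P" "y \<in> carrier ?P"
          "(case x of (N, T) \<Rightarrow> N ** T) = (case y of (N, T) \<Rightarrow> N ** T)"
        obtain N T N' T' where eq: "x = (N, T)" "y = (N', T')"
          by (cases x, cases y)
        show "x = y"
          using Dg_2_Dg_9_cancel[of N T N' T'] xy by (simp add: eq Nset_eq Vset_eq)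
      qed
      show "(\<lambda>(N, T). N ** T) ` carrier ?P = carrier (SU3\<lparr>carrier := NVset\<rparr>)"
        unfolding NVset_def by (simp add: image_def) blast
    qed
  qed
  ultimately show ?thesis
    using group.iso_sym is_isoI by blast
qed

lemma NVset_iso_cyclic:
  "SU3\<lparr>carrier := NVset\<rparr> \<cong> DirProd (integer_mod_group 18) (integer_mod_group 6)"
proof -
  let ?Z = "DirProd (integer_mod_group 18) (integer_mod_group 6)"
  have carrier: "carrier ?Z = {0..<18} \<times> {0..<6}"
    by (simp add: carrier_integer_mod_group)
  have "(\<lambda>(i, j). Cm i j) \<in> iso ?Z (SU3\<lparr>carrier := NVset\<rparr>)"
  proof (rule isoI)
    show "(\<lambda>(i, j). Cm i j) \<in> hom ?Z (SU3\<lparr>carrier := NVset\<rparr>)"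
    proof (rule homI)
      fix x assume "x \<in> carrier ?Z"
      then show "(case x of (i, j) \<Rightarrow> Cm i j) \<in> carrier (SU3\<lparr>carrier := NVset\<rparr>)"
        using bij_betw_imp_surj_on[OF Cm_bij] unfolding carrier by (force simp: NVset_eq)
    qed (auto simp: Cm_mult Cm_eq_iff mod_eq_dvd_iff[symmetric])
    show "bij_betw (\<lambda>(i, j). Cm i j) (carrier ?Z) (carrier (SU3\<lparr>carrier := NVset\<rparr>))"
      using Cm_bij unfolding carrier NVset_eq by simp
  qed
  then show ?thesis
    by (intro group.iso_sym[OF DirProd_group] is_isoI) simp_all
qed

text \<open>Conjugation by \<open>D ** H\<close> acts on \<open>Dg 1\<close> through
  \<open>H\<close> alone, because \<open>Dg 1\<close> is abelian; and \<open>H\<close> permutes the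
  exponents.\<close>

lemma NVset_normal: "NVset \<lhd> SU3\<lparr>carrier := Fr648\<rparr>"
proof -
  have sub: "subgroup Fr648 SU3"
    by (simp add: Fr648_eq subgroup_Mn)
  interpret F: group "SU3\<lparr>carrier := Fr648\<rparr>"
    using sub by (rule SU3.subgroup_imp_group)
  have "NVset \<subseteq> Fr648"
    unfolding NVset_eq Fr648_eq using MnI[of _ 1 "mat 1"] by (auto simp: Hset_def)
  then have "subgroup NVset (SU3\<lparr>carrier := Fr648\<rparr>)"
    using sub by (intro SU3.subgroup_incl) (simp_all add: NVset_eq subgroup_Dg)
  moreover have "x ** d ** inv\<^bsub>SU3\<^esub> x \<in> NVset" if "x \<in> Fr648" "d \<in> NVset" for x d
  proof -
    have d: "d \<in> Dg 1" "d \<in> carrier SU3"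
      using that subgroup.subset[OF subgroup_Dg] by (auto simp: NVset_eq)
    obtain D H where x: "x = D ** H" "D \<in> Dg 1" "H \<in> Hset"
      using \<open>x \<in> Fr648\<close> unfolding Fr648_eq Mn_def by blast
    obtain d' where d': "d' \<in> Dg 1" "H ** d = d' ** H"
      using H_Dg[OF x(3) d(1)] by blast
    have "x ** d = D ** (H ** d)"
      by (simp add: x(1) matrix_mul_assoc)
    also have "\<dots> = (D ** d') ** H"
      by (simp add: d'(2) matrix_mul_assoc)
    also have "\<dots> = d' ** x"
      by (simp add: Dg_commute[OF x(2) d'(1)] x(1) matrix_mul_assoc)
    finally have "x ** d = d' ** x" .
    moreover have "x \<in> carrier SU3" "d' \<in> carrier SU3"
      using that(1) subgroup.subset[OF sub] d'(1) subgroup.subset[OF subgroup_Dg] by blast+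
    ultimately have "x ** d ** inv\<^bsub>SU3\<^esub> x = d'"
      using SU3.inv_solve_right'[of d' "x ** d" x] d(2) SU3.m_closed[of x d] by simp
    with d' show ?thesis by (simp add: NVset_eq)
  qed
  ultimately show ?thesis
    unfolding F.normal_inv_iff using SU3.m_inv_consistent[OF sub] by simp
qed

section \<open>The complement\<close>

text \<open>\<open>H\<close> acts on the three common eigenlines of the matrices \<open>dg x y z\<close>.\<close>

abbreviation transposition :: "nat \<Rightarrow> nat \<Rightarrow> nat \<Rightarrow> nat" where
  "transposition \<equiv> Transposition.transpose"

text \<open>The composites follow \<open>H3 = H2 ** H1\<close> and \<open>H4 = H1 ** H2\<close>,
  which makes the map multiplicative for composition. On \<open>Hset\<close> the default
  \<open>id\<close> is the value at \<open>mat 1\<close>.\<close>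

definition perm_of :: "cmat3 \<Rightarrow> nat \<Rightarrow> nat" where
  "perm_of H =
    (if H = H0 then transposition 1 3 else if H = H1 then transposition 2 3
     else if H = H2 then transposition 1 2
     else if H = H3 then transposition 1 2 \<circ> transposition 2 3
     else if H = H4 then transposition 2 3 \<circ> transposition 1 2 else id)"

lemma perm_of_simps:
  "perm_of (mat 1) = id" "perm_of H0 = transposition 1 3" "perm_of H1 = transposition 2 3"
  "perm_of H2 = transposition 1 2" "perm_of H3 = transposition 1 2 \<circ> transposition 2 3"
  "perm_of H4 = transposition 2 3 \<circ> transposition 1 2"
  using H_distinct by (auto simp: perm_of_def)

lemma Hset_iso_sym_group: "SU3\<lparr>carrier := Hset\<rparr> \<cong> sym_group 3"
proof (rule is_isoI, rule isoI)
  have perm: "perm_of H permutes {1..3}" if "H \<in> Hset" for H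
  proof -
    have "transposition 1 3 permutes {1..3::nat}" "transposition 2 3 permutes {1..3::nat}"
      "transposition 1 2 permutes {1..3::nat}"
      by (rule permutes_swap_id; simp)+
    then show ?thesis
      using that by (auto simp: Hset_def perm_of_simps permutes_id intro: permutes_compose)
  qed
  show "perm_of \<in> hom (SU3\<lparr>carrier := Hset\<rparr>) (sym_group 3)"
  proof (rule homI)
    fix x y assume "x \<in> carrier (SU3\<lparr>carrier := Hset\<rparr>)" "y \<in> carrier (SU3\<lparr>carrier := Hset\<rparr>)"
    then show "perm_of (x \<otimes>\<^bsub>SU3\<lparr>carrier := Hset\<rparr>\<^esub> y) = perm_of x \<otimes>\<^bsub>sym_group 3\<^esub> perm_of y"
      by (auto simp: Hset_def sym_group_mult H_table perm_of_simps fun_eq_iff Transposition.transpose_def)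
  qed (use perm in \<open>simp add: sym_group_carrier\<close>)
  have inj: "inj_on perm_of Hset"
  proof (rule inj_onI)
    fix x y assume xy: "x \<in> Hset" "y \<in> Hset" "perm_of x = perm_of y"
    \<comment> \<open>A permutation of three points is determined by two of its values.\<close>
    then have "perm_of x 1 = perm_of y 1" "perm_of x 2 = perm_of y 2"
      by simp_all
    with xy(1,2) show "x = y"
      by (auto simp: Hset_def perm_of_simps Transposition.transpose_def)
  qed
  \<comment> \<open>Surjectivity by counting: both sides have six elements.\<close>
  have "card (perm_of ` Hset) = card (carrier (sym_group 3))"
    using card_Hset card_image[OF inj] by (simp add: sym_group_card_carrier fact_numeral)
  moreover have "perm_of ` Hset \<subseteq> carrier (sym_group 3)"
    using perm by (auto simp: sym_group_carrier)
  moreover have "finite (carrier (sym_group 3))"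
    using sym_group_card_carrier[of 3] by (intro card_ge_0_finite) simp
  ultimately have "perm_of ` Hset = carrier (sym_group 3)"
    by (simp add: card_subset_eq)
  with inj show "bij_betw perm_of (carrier (SU3\<lparr>carrier := Hset\<rparr>)) (carrier (sym_group 3))"
    by (simp add: bij_betw_def)
qed

section \<open>The group D(9,1,1;2,1,1)\<close>

text \<open>\<open>Qm\<close> is its own inverse, so the map in question is conjugation.\<close>

lemma Qm_conj_mult: "(Qm ** M ** Qm) ** (Qm ** N ** Qm) = Qm ** (M ** N) ** Qm"
proof -
  have "(Qm ** M ** Qm) ** (Qm ** N ** Qm) = Qm ** M ** (Qm ** Qm) ** N ** Qm"
    by (simp only: matrix_mul_assoc)
  then show ?thesis
    by (simp add: Qm_Qm matrix_mul_assoc)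
qed

lemma Qm_conj_hom: "(\<lambda>M. Qm ** M ** Qm) \<in> hom SU3 SU3"
proof (rule homI)
  fix M assume "M \<in> carrier SU3"
  then have M: "ctrans M ** M = mat 1" "det M = 1"
    by (simp_all add: SU3_carrier)
  have "ctrans Qm = Qm"
    by (simp add: Qm_def ctrans_mat3 cnj_rt)
  then have "ctrans (Qm ** M ** Qm) = Qm ** ctrans M ** Qm"
    by (simp add: ctrans_mult matrix_mul_assoc)
  \<comment> \<open>\<open>Qm\<close> has determinant -1; only the square enters.\<close>
  moreover have "det Qm * det Qm = 1"
    by (metis Qm_Qm det_I det_mul)
  ultimately show "Qm ** M ** Qm \<in> carrier SU3"
    using M by (simp add: SU3_carrier Qm_conj_mult Qm_Qm det_mul)
qed (simp add: Qm_conj_mult)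

lemma Qm_conj_inj: "inj (\<lambda>M. Qm ** M ** Qm)"
proof (rule injI)
  fix M N assume "Qm ** M ** Qm = Qm ** N ** Qm"
  then have "Qm ** (Qm ** M ** Qm) ** Qm = Qm ** (Qm ** N ** Qm) ** Qm"
    by simp
  then have "(Qm ** Qm) ** M ** (Qm ** Qm) = (Qm ** Qm) ** N ** (Qm ** Qm)"
    by (simp only: matrix_mul_assoc)
  then show "M = N"
    by (simp add: Qm_Qm)
qed

lemma Qm_conj_monomial:
  "Qm ** mat3 0 1 0 0 0 1 1 0 0 ** Qm = H4"
  "Qm ** mat3 (-1) 0 0 0 0 (-1) 0 (-1) 0 ** Qm = H1"
  by (simp_all add: Qm_def H_mat3 mat3_mult mat3_eq_iff rt_rt)

text \<open>The three generators are the images of those of \<open>D9\<close> under conjugation by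
  \<open>Qm\<close>.\<close>

lemma Mn_2_eq_generate: "Mn 2 = generate SU3 {Em 2 2 (- 4), H4, H1}"
proof
  have "Em 2 2 (- 4) ** mat 1 \<in> Mn 2" "Em 0 0 0 ** H4 \<in> Mn 2"
    by (auto simp: Hset_def simp del: matrix_mul_rid intro!: MnI DgI)
  then have gens: "{Em 2 2 (- 4), H4, H1} \<subseteq> Mn 2"
    by (simp add: Em_0 generators_in_Mn)
  then show "generate SU3 {Em 2 2 (- 4), H4, H1} \<subseteq> Mn 2"
    by (rule SU3.generate_subgroup_incl) (rule subgroup_Mn)
  define S where "S = generate SU3 {Em 2 2 (- 4), H4, H1}"
  have S: "subgroup S SU3"
    unfolding S_def using gens subgroup.subset[OF subgroup_Mn]
    by (intro SU3.generate_is_subgroup) blast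
  have mem: "Em 2 2 (- 4) \<in> S" "H4 \<in> S" "H1 \<in> S"
    unfolding S_def by (auto intro: generate.incl)
  note mult = subgroup.m_closed[OF S, simplified]
  have H3: "H3 \<in> S"
    using mult[OF mem(2,2)] by (simp add: H_table)
  \<comment> \<open>Conjugation by the 3-cycles moves the exponent -4 to the other two
    positions.\<close>
  have perms: "Em (- 4) 2 2 \<in> S" "Em 2 (- 4) 2 \<in> S"
    using mult[OF mult[OF H3 mem(1)] mem(2)] mult[OF mult[OF mem(2,1)] H3]
    by (simp_all add: monomial_normalise)
  \<comment> \<open>Modulo 18 these are the exponents of \<open>Amat\<close> and
    \<open>Bmat\<close>.\<close>
  have "Em 8 (- 4) (- 4) \<in> S" "Em 6 (- 6) 0 \<in> S"
    using Em_multiple_in_subgroup[OF S perms(1), of "- 2"]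
      Em_combination_in_subgroup[OF S perms(2,1), of 1 "- 1"] by simp_all
  then have "Amat \<in> S" "Bmat \<in> S"
    by (simp_all add: Amat_eq Bmat_eq Em_eq_iff
        Em_eq_iff[of 8 14 14 8 "- 4" "- 4", THEN iffD2] Em_eq_iff[of 6 12 0 6 "- 6" 0, THEN iffD2])
  then show "Mn 2 \<subseteq> generate SU3 {Em 2 2 (- 4), H4, H1}"
    using Mn_subset[OF S Dg_2_subset[OF S] mem(3) H3] by (simp add: S_def)
qed

lemma Fr162_iso_D9: "SU3\<lparr>carrier := Fr162\<rparr> \<cong> SU3\<lparr>carrier := D9\<rparr>"
proof -
  let ?h = "\<lambda>M. Qm ** M ** Qm"
  define gens where "gens = {mat3 (cis (2*pi/9)) 0 0 0 (cis (2*pi/9)) 0 0 0 (cis (-4*pi/9)),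
    mat3 0 1 0 0 0 1 1 0 0, mat3 (-1) 0 0 0 0 (-1) 0 (-1) 0}"
  have D9: "D9 = generate SU3 gens"
    by (simp add: D9_def gens_def)
  interpret h: group_hom SU3 SU3 ?h
    using Qm_conj_hom by unfold_locales
  have gens_SU3: "gens \<subseteq> carrier SU3"
    unfolding gens_def zeta_cis
    by (simp add: SU3_carrier ctrans_mat3 mat3_mult mat3_one mat3_eq_iff det_mat3 cnj_zeta
        flip: zeta_add)
  have "?h ` gens = {Em 2 2 (- 4), H4, H1}"
    unfolding gens_def zeta_cis by (simp add: Qm_diag Qm_conj_monomial Em_def)
  then have image: "?h ` D9 = Fr162"
    using h.generate_img[OF gens_SU3] by (simp add: D9 Fr162_eq Mn_2_eq_generate)
  have "subgroup D9 SU3"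
    unfolding D9 by (rule SU3.generate_is_subgroup[OF gens_SU3])
  then have "group (SU3\<lparr>carrier := D9\<rparr>)"
    by (rule SU3.subgroup_imp_group)
  moreover have "?h \<in> iso (SU3\<lparr>carrier := D9\<rparr>) (SU3\<lparr>carrier := Fr162\<rparr>)"
    using image Qm_conj_inj
    by (intro isoI homI) (auto simp: Qm_conj_mult bij_betw_def inj_on_def)
  ultimately show ?thesis
    using group.iso_sym is_isoI by blast
qed

section \<open>Normal forms\<close>

lemma A_B_pow: "Amat [^]\<^bsub>SU3\<^esub> i ** Bmat [^]\<^bsub>SU3\<^esub> j =
    Em (8 * int i + 6 * int j) (14 * int i + 12 * int j) (14 * int i)"
  by (simp add: Amat_eq Bmat_eq Em_pow Em_mult mult.commute)

lemma A_B_pow_in_Dg: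
  fixes i j :: nat
  shows "Amat [^]\<^bsub>SU3\<^esub> i ** Bmat [^]\<^bsub>SU3\<^esub> j \<in> Dg 2"
  using Em_combination_in_subgroup[OF subgroup_Dg[of 2] DgI DgI, of 8 14 14 6 12 0 "int i" "int j"]
  by (simp add: A_B_pow mult.commute)

lemma A_B_pow_unique:
  fixes i j i' j' :: nat
  assumes "Amat [^]\<^bsub>SU3\<^esub> i ** Bmat [^]\<^bsub>SU3\<^esub> j = Amat [^]\<^bsub>SU3\<^esub> i' ** Bmat [^]\<^bsub>SU3\<^esub> j'"
    and "i \<le> 8" "i' \<le> 8" "j \<le> 2" "j' \<le> 2"
  shows "i = i' \<and> j = j'"
proof -
  have dvd: "18 dvd (8 * int i + 6 * int j - (8 * int i' + 6 * int j'))"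
    "18 dvd (14 * int i - 14 * int i')"
    using assms(1) by (simp_all add: A_B_pow Em_eq_iff)
  \<comment> \<open>The third exponent involves \<open>i\<close> alone. Modulo 18, the multiples of
    14 repeat with period nine and those of 6 with period three, which matches the ranges of
    \<open>i\<close> and \<open>j\<close>.\<close>
  have small: "x = 0" if "18 dvd 14 * x" "\<bar>x\<bar> \<le> 8" for x :: int
    using that by presburger
  have small': "x = 0" if "18 dvd 6 * x" "\<bar>x\<bar> \<le> 2" for x :: int
    using that by presburger
  have "i = i'"
    using small[of "int i - int i'"] dvd(2) assms(2,3) by (simp add: right_diff_distrib)
  moreover from this have "j = j'"
    using small'[of "int j - int j'"] dvd(1) assms(4,5) by (simp add: right_diff_distrib)
  ultimately show ?thesis ..
qed

lemma A_B_pow_exists: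
  assumes "D \<in> Dg 2"
  shows "\<exists>i j. i \<le> 8 \<and> j \<le> 2 \<and> D = Amat [^]\<^bsub>SU3\<^esub> (i::nat) ** Bmat [^]\<^bsub>SU3\<^esub> (j::nat)"
proof -
  obtain i j where D: "D = Em (i * 8 + j * 6) (i * 14 + j * 12) (i * 14 + j * 0)"
    using assms Dg_2_eq by (metis DgE)
  \<comment> \<open>\<open>Amat\<close> has order nine and \<open>Bmat\<close> order three.\<close>
  define k l where "k = nat (i mod 9)" and "l = nat (j mod 3)"
  obtain q r where "i = 9 * q + int k" "j = 3 * r + int l"
    by (metis k_def l_def int_nat_eq mult_div_mod_eq pos_mod_sign zero_less_numeral)
  then have "i * 8 + j * 6 - (8 * int k + 6 * int l) = 18 * (4 * q + r)"
    "i * 14 + j * 12 - (14 * int k + 12 * int l) = 18 * (7 * q + 2 * r)"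
    "i * 14 + j * 0 - 14 * int k = 18 * (7 * q)"
    by simp_all
  then have "D = Amat [^]\<^bsub>SU3\<^esub> k ** Bmat [^]\<^bsub>SU3\<^esub> l"
    unfolding D A_B_pow Em_eq_iff by (metis dvd_triv_left)
  moreover have "k \<le> 8" "l \<le> 2"
    by (simp_all add: k_def l_def)
  ultimately show ?thesis by blast
qed

text \<open>Uniqueness peels off the factors from the right: \<open>H\<close> because
  \<open>Dg 1\<close> meets \<open>Hset\<close> trivially, then \<open>T\<close> because
  \<open>Dg 2\<close> meets \<open>Dg 9\<close> trivially, and finally the two exponents.\<close>

lemma Fr648_normal_form:
  assumes "M \<in> Fr648"
  shows "\<exists>!(i, j, T, H). i \<le> (8::nat) \<and> j \<le> (2::nat) \<and> T \<in> Vset \<and> H \<in> Hset \<and>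
    M = Amat [^]\<^bsub>SU3\<^esub> i ** Bmat [^]\<^bsub>SU3\<^esub> j ** T ** H"
proof -
  obtain D H where DH: "M = D ** H" "D \<in> Dg 1" "H \<in> Hset"
    using assms unfolding Fr648_eq Mn_def by blast
  then obtain N T where NT: "D = N ** T" "N \<in> Dg 2" "T \<in> Vset"
    unfolding NVset_eq[symmetric] NVset_def Nset_eq by blast
  obtain i j :: nat where ij: "i \<le> 8" "j \<le> 2" "N = Amat [^]\<^bsub>SU3\<^esub> i ** Bmat [^]\<^bsub>SU3\<^esub> j"
    using A_B_pow_exists[OF NT(2)] by blast
  show ?thesis
  proof (rule ex1I[of _ "(i, j, T, H)"])
    show "case (i, j, T, H) of (i, j, T, H) \<Rightarrow> i \<le> 8 \<and> j \<le> 2 \<and> T \<in> Vset \<and> H \<in> Hset \<and>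
        M = Amat [^]\<^bsub>SU3\<^esub> i ** Bmat [^]\<^bsub>SU3\<^esub> j ** T ** H"
      using DH NT ij by simp
  next
    fix x :: "nat \<times> nat \<times> cmat3 \<times> cmat3"
    assume x: "case x of (i, j, T, H) \<Rightarrow> i \<le> 8 \<and> j \<le> 2 \<and> T \<in> Vset \<and> H \<in> Hset \<and>
        M = Amat [^]\<^bsub>SU3\<^esub> i ** Bmat [^]\<^bsub>SU3\<^esub> j ** T ** H"
    obtain i' j' :: nat and T' H' where eq: "x = (i', j', T', H')"
      by (cases x) auto
    let ?N = "Amat [^]\<^bsub>SU3\<^esub> i' ** Bmat [^]\<^bsub>SU3\<^esub> j'"
    have x': "i' \<le> 8" "j' \<le> 2" "T' \<in> Vset" "H' \<in> Hset" "M = ?N ** T' ** H'"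
      using x by (simp_all add: eq)
    have "?N ** T' \<in> Dg 1"
      using A_B_pow_in_Dg[of i' j'] x'(3) unfolding NVset_eq[symmetric] NVset_def Nset_eq by blast
    then have "D = ?N ** T'" "H = H'"
      using Dg_Hset_cancel[of D H "?N ** T'" H' 1] DH x' by simp_all
    moreover from this have "N = ?N" "T = T'"
      using Dg_2_Dg_9_cancel[of N T ?N T'] NT x'(3) A_B_pow_in_Dg[of i' j'] by (simp_all add: Vset_eq)
    ultimately show "x = (i, j, T, H)"
      using A_B_pow_unique[of i j i' j'] ij x'(1,2) by (simp add: eq)
  qed
qed

section \<open>Consequences of the relations in an arbitrary group\<close>

text \<open>Finite order makes the inverse of a generator a natural power of it, so closure under
  left multiplication by generators is enough. The induction shows that every element of the
  subgroup maps \<open>W\<close> into itself; applied to the unit this gives membership.\<close>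

lemma (in group) generate_subset_if_closed:
  assumes S: "S \<subseteq> carrier G" and W: "W \<subseteq> carrier G" "\<one> \<in> W"
    and closed: "\<And>s x. s \<in> S \<Longrightarrow> x \<in> W \<Longrightarrow> s \<otimes> x \<in> W"
    and torsion: "\<And>s. s \<in> S \<Longrightarrow> \<exists>n::nat. s [^] Suc n = \<one>"
  shows "generate G S \<subseteq> W"
proof -
  have "g \<otimes> x \<in> W" if "g \<in> generate G S" "x \<in> W" for g x
    using that
  proof (induction arbitrary: x rule: generate.induct)
    case one
    then show ?case using W by auto
  next
    case (incl s)
    then show ?case by (simp add: closed)
  next
    case (inv s)
    then obtain n :: nat where n: "s [^] Suc n = \<one>"
      using torsion by blast
    have "inv s = s [^] n"
      using n inv(1) S by (intro inv_equality) auto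
    moreover have "s [^] n \<otimes> x \<in> W" for n :: nat
    proof (induction n)
      case 0
      then show ?case using inv W by auto
    next
      case (Suc n)
      have "s \<in> carrier G" "x \<in> carrier G"
        using inv S W by auto
      then have "s [^] Suc n \<otimes> x = s \<otimes> (s [^] n \<otimes> x)"
        by (subst nat_pow_Suc2) (simp_all add: m_assoc)
      then show ?case using Suc closed inv by simp
    qed
    ultimately show ?case by simp
  next
    case (eng g h)
    then have "g \<in> carrier G" "h \<in> carrier G" "x \<in> carrier G"
      using generate_in_carrier[OF S] W by auto
    then show ?case using eng by (simp add: m_assoc)
  qed
  then have "g \<in> W" if "g \<in> generate G S" for g
    using that W generate_in_carrier[OF S that] by fastforce
  then show ?thesis by blast
qed

lemma (in group) pow_intertwine:
  assumes "h \<in> carrier G" "c \<in> carrier G" "d \<in> carrier G" "h \<otimes> c = d \<otimes> h"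
  shows "h \<otimes> c [^] (n::nat) = d [^] n \<otimes> h"
proof (induction n)
  case 0
  then show ?case using assms by simp
next
  case (Suc n)
  have "h \<otimes> c [^] Suc n = (h \<otimes> c [^] n) \<otimes> c"
    using assms by (simp add: m_assoc)
  also have "\<dots> = d [^] n \<otimes> (h \<otimes> c)"
    using assms by (simp add: Suc m_assoc)
  also have "\<dots> = d [^] Suc n \<otimes> h"
    using assms by (simp add: m_assoc)
  finally show ?case .
qed

text \<open>The words of this form are closed under left multiplication by each generator:
  \<open>c6\<close> and \<open>c18\<close> commute, \<open>h1\<close> and \<open>h3\<close>
  normalise their products, and \<open>h3\<close> can be moved past \<open>h1\<close>. The exponents
  stay unreduced.\<close>

lemma (in group) pres_rels_normal_form:
  assumes carr: "c6 \<in> carrier G" "c18 \<in> carrier G" "h1 \<in> carrier G" "h3 \<in> carrier G"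
    and rels: "pres_rels G c6 c18 h1 h3"
    and x: "x \<in> generate G {c6, c18, h1, h3}"
  shows "\<exists>i j k l. x = (c6 [^] (i::nat) \<otimes> c18 [^] (j::nat)) \<otimes> (h1 [^] (k::nat) \<otimes> h3 [^] (l::nat))"
proof -
  note [simp] = carr
  have R: "c6 [^] (6::nat) = \<one>" "c18 [^] (18::nat) = \<one>" "c6 \<otimes> c18 \<otimes> inv c6 \<otimes> inv c18 = \<one>"
    "h1 [^] (2::nat) = \<one>" "h3 [^] (3::nat) = \<one>" "(h1 \<otimes> h3) [^] (2::nat) = \<one>"
    "h1 \<otimes> c6 \<otimes> inv h1 = inv c6 \<otimes> c18 [^] (6::nat)"
    "h1 \<otimes> c18 \<otimes> inv h1 = c6 [^] (3::nat) \<otimes> c18"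
    "h3 \<otimes> c6 \<otimes> inv h3 = c6 \<otimes> inv (c18 [^] (3::nat))"
    "h3 \<otimes> c18 \<otimes> inv h3 = c6 \<otimes> c18 [^] (10::nat)"
    using rels unfolding pres_rels_def by blast+
  have move: "g \<otimes> c = d \<otimes> g" if "g \<otimes> c \<otimes> inv g = d" "g \<in> carrier G" "c \<in> carrier G" for g c d
    using that by (metis inv_closed inv_solve_right m_closed)
  have comm: "c6 \<otimes> c18 = c18 \<otimes> c6"
  proof (rule move)
    show "c6 \<otimes> c18 \<otimes> inv c6 = c18"
      using R(3) by (metis carr(1,2) inv_closed inv_equality inv_inv m_closed)
  qed simp_all
  \<comment> \<open>The conjugation relations contain inverses; as natural powers these fall into
    the set \<open>P\<close> below.\<close>
  have inv6: "inv c6 = c6 [^] (5::nat)"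
    using R(1) by (intro inv_equality) (simp_all add: numeral_eq_Suc)
  have inv18: "inv (c18 [^] (3::nat)) = c18 [^] (15::nat)"
    using R(2) by (intro inv_equality) (simp_all add: nat_pow_mult)
  define P where "P = {c6 [^] i \<otimes> c18 [^] j | (i::nat) (j::nat). True}"
  have P_carr: "p \<in> carrier G" if "p \<in> P" for p
    using that by (auto simp: P_def)
  have comm_pow: "c6 [^] (i::nat) \<otimes> c18 [^] (j::nat) = c18 [^] j \<otimes> c6 [^] i" for i j
    using pow_intertwine[of "c18 [^] j" c6 c6 i] pow_intertwine[of c6 c18 c18 j] comm by simp
  have P_I: "c6 [^] i \<otimes> c18 [^] j \<in> P" for i j :: nat
    unfolding P_def by blast
  have P_mult: "p \<otimes> q \<in> P" if p: "p \<in> P" and q: "q \<in> P" for p q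
  proof -
    obtain i j i' j' :: nat where pq: "p = c6 [^] i \<otimes> c18 [^] j" "q = c6 [^] i' \<otimes> c18 [^] j'"
      using p q unfolding P_def by blast
    have "p \<otimes> q = c6 [^] i \<otimes> (c18 [^] j \<otimes> c6 [^] i') \<otimes> c18 [^] j'"
      by (simp add: pq m_assoc)
    also have "\<dots> = c6 [^] i \<otimes> (c6 [^] i' \<otimes> c18 [^] j) \<otimes> c18 [^] j'"
      by (simp add: comm_pow)
    also have "\<dots> = (c6 [^] i \<otimes> c6 [^] i') \<otimes> (c18 [^] j \<otimes> c18 [^] j')"
      by (simp add: m_assoc)
    also have "\<dots> = c6 [^] (i + i') \<otimes> c18 [^] (j + j')"
      by (simp add: nat_pow_mult)
    finally show ?thesis using P_I by simp
  qed
  have P_pow: "p [^] n \<in> P" if "p \<in> P" for p and n :: nat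
  proof (induction n)
    case 0
    then show ?case using P_I[of 0 0] by simp
  next
    case (Suc n)
    then show ?case using P_mult that by simp
  qed
  have P_gens: "c6 \<in> P" "c18 \<in> P"
    using P_I[of 1 0] P_I[of 0 1] by simp_all
  have P_normalised: "\<exists>p'\<in>P. h \<otimes> p = p' \<otimes> h"
    if h: "h \<in> carrier G" "h \<otimes> c6 = d \<otimes> h" "h \<otimes> c18 = e \<otimes> h" and de: "d \<in> P" "e \<in> P" and p: "p \<in> P"
    for h d e p
  proof -
    obtain i j :: nat where p: "p = c6 [^] i \<otimes> c18 [^] j"
      using p unfolding P_def by blast
    have de_carr: "d \<in> carrier G" "e \<in> carrier G"
      using de P_carr by auto
    have "h \<otimes> p = (h \<otimes> c6 [^] i) \<otimes> c18 [^] j"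
      using h(1) by (simp add: p m_assoc)
    also have "\<dots> = d [^] i \<otimes> (h \<otimes> c18 [^] j)"
      using pow_intertwine[of h c6 d i] h de_carr by (simp add: m_assoc)
    also have "\<dots> = (d [^] i \<otimes> e [^] j) \<otimes> h"
      using pow_intertwine[of h c18 e j] h de_carr by (simp add: m_assoc)
    finally show ?thesis
      using P_mult P_pow de by blast
  qed
  have h1_P: "\<exists>p'\<in>P. h1 \<otimes> p = p' \<otimes> h1" if "p \<in> P" for p
    using that R(7,8)[THEN move] P_I[of 5 6] P_I[of 3 1]
    by (intro P_normalised[of h1 "c6 [^] (5::nat) \<otimes> c18 [^] (6::nat)" "c6 [^] (3::nat) \<otimes> c18"])
      (simp_all add: inv6)
  have h3_P: "\<exists>p'\<in>P. h3 \<otimes> p = p' \<otimes> h3" if "p \<in> P" for p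
    using that R(9,10)[THEN move] P_I[of 1 15] P_I[of 1 10]
    by (intro P_normalised[of h3 "c6 \<otimes> c18 [^] (15::nat)" "c6 \<otimes> c18 [^] (10::nat)"])
      (simp_all add: inv18)
  \<comment> \<open>The dihedral relation: \<open>(h1 \<otimes> h3) [^] 2 = \<one>\<close> says that
    \<open>h1\<close> inverts \<open>h3\<close>, and the inverse of \<open>h3\<close> is its
    square.\<close>
  have h3_h1: "h3 \<otimes> h1 = h1 \<otimes> h3 [^] (2::nat)"
  proof -
    have "h1 \<otimes> (h3 \<otimes> h1 \<otimes> h3) = \<one>" "h1 \<otimes> h1 = \<one>" "h3 [^] (2::nat) \<otimes> h3 = \<one>"
      using R(4-6) by (simp_all add: numeral_eq_Suc m_assoc)
    then have "h3 \<otimes> h1 \<otimes> h3 = h1"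
      by (metis carr(3,4) l_cancel m_closed)
    then have "h3 \<otimes> h1 \<otimes> h3 = (h1 \<otimes> h3 [^] (2::nat)) \<otimes> h3"
      using \<open>h3 [^] (2::nat) \<otimes> h3 = \<one>\<close> by (simp add: m_assoc)
    then show ?thesis
      by (subst (asm) right_cancel) simp_all
  qed
  \<comment> \<open>Each \<open>h1\<close> that is passed doubles the exponent of
    \<open>h3\<close>.\<close>
  have h3_pow: "\<exists>m::nat. h3 [^] n \<otimes> h1 [^] k = h1 [^] k \<otimes> h3 [^] m" for n k :: nat
  proof (induction k arbitrary: n)
    case 0
    then show ?case by (intro exI[of _ n]) simp
  next
    case (Suc k)
    obtain m :: nat where m: "h3 [^] n \<otimes> h1 [^] k = h1 [^] k \<otimes> h3 [^] m"
      using Suc by blast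
    have flip: "h3 [^] r \<otimes> h1 = h1 \<otimes> h3 [^] (2 * r)" for r :: nat
    proof (induction r)
      case 0
      then show ?case by simp
    next
      case (Suc r)
      have "h3 [^] Suc r \<otimes> h1 = h3 [^] r \<otimes> (h3 \<otimes> h1)"
        by (simp add: m_assoc)
      also have "\<dots> = (h3 [^] r \<otimes> h1) \<otimes> h3 [^] (2::nat)"
        by (simp add: h3_h1 m_assoc)
      also have "\<dots> = h1 \<otimes> h3 [^] (2 * Suc r)"
        by (simp add: Suc m_assoc nat_pow_mult)
      finally show ?case .
    qed
    have "h3 [^] n \<otimes> h1 [^] Suc k = (h3 [^] n \<otimes> h1 [^] k) \<otimes> h1"
      by (simp add: m_assoc)
    also have "\<dots> = h1 [^] k \<otimes> (h3 [^] m \<otimes> h1)"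
      by (simp add: m m_assoc)
    also have "\<dots> = h1 [^] Suc k \<otimes> h3 [^] (2 * m)"
      by (simp add: flip m_assoc)
    finally show ?case by blast
  qed
  define W where "W = {p \<otimes> (h1 [^] k \<otimes> h3 [^] l) | p (k::nat) (l::nat). p \<in> P}"
  have W_I: "p \<otimes> (h1 [^] k \<otimes> h3 [^] l) \<in> W" if "p \<in> P" for p and k l :: nat
    using that unfolding W_def by blast
  have "generate G {c6, c18, h1, h3} \<subseteq> W"
  proof (rule generate_subset_if_closed)
    show "W \<subseteq> carrier G"
      using P_carr by (auto simp: W_def)
    show "\<one> \<in> W"
      using W_I[OF P_I[of 0 0], of 0 0] by simp
    fix s x assume s: "s \<in> {c6, c18, h1, h3}" and "x \<in> W"
    then obtain p and k l :: nat where x: "x = p \<otimes> (h1 [^] k \<otimes> h3 [^] l)" "p \<in> P"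
      unfolding W_def by blast
    have [simp]: "p \<in> carrier G"
      using x P_carr by blast
    consider "s \<in> P" | "s = h1" | "s = h3"
      using s P_gens by blast
    then show "s \<otimes> x \<in> W"
    proof cases
      case 1
      have "s \<otimes> x = (s \<otimes> p) \<otimes> (h1 [^] k \<otimes> h3 [^] l)"
        using P_carr[OF 1] by (simp add: x m_assoc)
      then show ?thesis using W_I P_mult 1 x by simp
    next
      case 2
      obtain p' where p': "p' \<in> P" "h1 \<otimes> p = p' \<otimes> h1"
        using h1_P x by blast
      have "s \<otimes> x = (h1 \<otimes> p) \<otimes> (h1 [^] k \<otimes> h3 [^] l)"
        by (simp add: x 2 m_assoc)
      also have "\<dots> = p' \<otimes> (h1 [^] Suc k \<otimes> h3 [^] l)"
        using P_carr[OF p'(1)] by (subst nat_pow_Suc2) (simp_all add: p' m_assoc)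
      finally show ?thesis using W_I[OF p'(1), of "Suc k" l] by (simp only:)
    next
      case 3
      obtain p' where p': "p' \<in> P" "h3 \<otimes> p = p' \<otimes> h3"
        using h3_P x by blast
      obtain m :: nat where m: "h3 [^] (1::nat) \<otimes> h1 [^] k = h1 [^] k \<otimes> h3 [^] m"
        using h3_pow by blast
      have "s \<otimes> x = (h3 \<otimes> p) \<otimes> (h1 [^] k \<otimes> h3 [^] l)"
        by (simp add: x 3 m_assoc)
      also have "\<dots> = p' \<otimes> ((h3 [^] (1::nat) \<otimes> h1 [^] k) \<otimes> h3 [^] l)"
        using P_carr[OF p'(1)] by (simp add: p' m_assoc)
      also have "\<dots> = p' \<otimes> (h1 [^] k \<otimes> h3 [^] (m + l))"
        unfolding m using P_carr[OF p'(1)] by (simp add: m_assoc nat_pow_mult)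
      finally show ?thesis using W_I p' by simp
    qed
  next
    fix s assume "s \<in> {c6, c18, h1, h3}"
    \<comment> \<open>The orders 6, 18, 2 and 3, written as successors.\<close>
    then have "s [^] Suc 5 = \<one> \<or> s [^] Suc 17 = \<one> \<or> s [^] Suc 1 = \<one> \<or> s [^] Suc 2 = \<one>"
      using R(1,2,4,5) by (auto simp del: nat_pow_Suc simp: eval_nat_numeral)
    then show "\<exists>n::nat. s [^] Suc n = \<one>" by blast
  qed simp
  with x have "x \<in> W" by blast
  then show ?thesis
    unfolding W_def P_def by blast
qed

section \<open>The presentation\<close>

lemma H1_pow: "H1 [^]\<^bsub>SU3\<^esub> (k::nat) = (if even k then mat 1 else H1)"
  by (induction k) (simp_all add: H_table)

lemma H3_pow: "H3 [^]\<^bsub>SU3\<^esub> (l::nat) = (if l mod 3 = 0 then mat 1 else if l mod 3 = 1 then H3 else H4)"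
  by (induction l) (auto simp: H_table mod_Suc)

lemma pres_rels_SU3: "pres_rels SU3 C6 C18 H1 H3"
proof -
  have "inv\<^bsub>SU3\<^esub> H1 = H1" "inv\<^bsub>SU3\<^esub> H3 = H4"
    by (simp_all add: inv_SU3_unique H_in_SU3 H_table)
  moreover have "(H1 ** H3) [^]\<^bsub>SU3\<^esub> (2::nat) = mat 1"
    by (simp add: numeral_2_eq_2 H_table)
  ultimately show ?thesis
    unfolding pres_rels_def
    by (simp add: C_eq Em_pow inv_Em H1_pow H3_pow monomial_normalise Em_eq_iff Em_eq_1_iff)
qed

text \<open>The diagonal part and the part in \<open>Hset\<close> must be trivial separately, so in
  the matrix group a normal form is trivial only when the orders of the generators force it. Hence
  the presentation lacks no relation.\<close>

lemma normal_form_eq_1: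
  fixes i j k l :: nat
  assumes "(C6 [^]\<^bsub>SU3\<^esub> i ** C18 [^]\<^bsub>SU3\<^esub> j) ** (H1 [^]\<^bsub>SU3\<^esub> k ** H3 [^]\<^bsub>SU3\<^esub> l) = mat 1"
  shows "6 dvd i \<and> 18 dvd j \<and> 2 dvd k \<and> 3 dvd l"
proof -
  \<comment> \<open>The arguments swap because \<open>Cm\<close> takes the exponent of
    \<open>C18\<close> first.\<close>
  have C: "C6 [^]\<^bsub>SU3\<^esub> i ** C18 [^]\<^bsub>SU3\<^esub> j = Cm (int j) (int i)"
    by (simp add: C_eq Em_pow Em_mult Cm_def add.commute)
  \<comment> \<open>Reduced exponents lie in the range of \<open>Cm_bij\<close>, which yields
    membership in \<open>Dg 1\<close>.\<close>
  have "Cm (int j) (int i) = Cm (int (j mod 18)) (int (i mod 6))"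
    by (simp add: Cm_eq_iff mod_eq_dvd_iff[symmetric] zmod_int)
  then have "Cm (int j) (int i) \<in> Dg 1"
    using bij_betwE[OF Cm_bij, rule_format, of "(int (j mod 18), int (i mod 6))"] by simp
  moreover have H: "H1 [^]\<^bsub>SU3\<^esub> k ** H3 [^]\<^bsub>SU3\<^esub> l \<in> Hset"
    by (simp add: H1_pow H3_pow Hset_def H_table)
  moreover have "mat 1 \<in> Dg 1" "mat 1 \<in> Hset"
    using Dg_Int_Hset by blast+
  ultimately have "Cm (int j) (int i) = mat 1 \<and> H1 [^]\<^bsub>SU3\<^esub> k ** H3 [^]\<^bsub>SU3\<^esub> l = mat 1"
    using Dg_Hset_cancel[of "Cm (int j) (int i)" _ "mat 1" "mat 1"] assms by (simp add: C)
  moreover from this have "even k \<and> l mod 3 = 0"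
    using H_distinct by (auto simp: H1_pow H3_pow H_table split: if_splits)
  ultimately have "int 18 dvd int j" "int 6 dvd int i" "even k" "3 dvd l"
    by (auto simp: Cm_eq_1_iff)
  then show ?thesis
    unfolding int_dvd_int_iff by blast
qed

lemma pow_DirProd: "(x, y) [^]\<^bsub>G \<times>\<times> K\<^esub> (n::nat) = (x [^]\<^bsub>G\<^esub> n, y [^]\<^bsub>K\<^esub> n)"
  by (induction n) simp_all

lemma pres_rels_DirProd:
  assumes "group G" "group K" "pres_rels G a b c d" "pres_rels K a' b' c' d'"
    and "{a, b, c, d} \<subseteq> carrier G" "{a', b', c', d'} \<subseteq> carrier K"
  shows "pres_rels (G \<times>\<times> K) (a, a') (b, b') (c, c') (d, d')"
  using assms by (simp add: pres_rels_def pow_DirProd inv_DirProd monoid.nat_pow_closed group.is_monoid)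

lemma presentation_SU3:
  fixes K :: "('g, 'b) monoid_scheme"
  assumes K: "group K" "c6 \<in> carrier K" "c18 \<in> carrier K" "h1 \<in> carrier K" "h3 \<in> carrier K"
    and rels: "pres_rels K c6 c18 h1 h3"
  shows "\<exists>\<phi>. \<phi> \<in> hom (SU3\<lparr>carrier := Fr648\<rparr>) K \<and> \<phi> C6 = c6 \<and> \<phi> C18 = c18 \<and> \<phi> H1 = h1 \<and> \<phi> H3 = h3"
proof -
  interpret K: group K by fact
  define P where "P = SU3 \<times>\<times> K"
  interpret P: group P
    unfolding P_def by (rule DirProd_group[OF group_SU3 K(1)])
  let ?gens = "{(C6, c6), (C18, c18), (H1, h1), (H3, h3)}"
  define \<Gamma> where "\<Gamma> = generate P ?gens"
  have SU3_gens: "C6 \<in> carrier SU3" "C18 \<in> carrier SU3" "H1 \<in> carrier SU3" "H3 \<in> carrier SU3"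
    by (simp_all add: C_eq Em_in_SU3 H_in_SU3)
  have gens: "?gens \<subseteq> carrier P"
    using SU3_gens K by (simp add: P_def)
  have \<Gamma>: "subgroup \<Gamma> P"
    unfolding \<Gamma>_def using gens by (rule P.generate_is_subgroup)
  have "pres_rels P (C6, c6) (C18, c18) (H1, h1) (H3, h3)"
    unfolding P_def using K SU3_gens pres_rels_SU3 rels
    by (intro pres_rels_DirProd group_SU3) simp_all
  note normal_form = P.pres_rels_normal_form[OF _ _ _ _ this, folded \<Gamma>_def]
  \<comment> \<open>The trivial first component makes the exponents multiples of 6, 18, 2 and 3, and
    the relations in \<open>K\<close> then kill the second component.\<close>
  have kernel: "y = \<one>\<^bsub>K\<^esub>" if "(mat 1, y) \<in> \<Gamma>" for y
  proof -
    obtain i j k l :: nat where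
      "(mat 1, y) = ((C6, c6) [^]\<^bsub>P\<^esub> i \<otimes>\<^bsub>P\<^esub> (C18, c18) [^]\<^bsub>P\<^esub> j) \<otimes>\<^bsub>P\<^esub>
        ((H1, h1) [^]\<^bsub>P\<^esub> k \<otimes>\<^bsub>P\<^esub> (H3, h3) [^]\<^bsub>P\<^esub> l)"
      using normal_form \<open>(mat 1, y) \<in> \<Gamma>\<close> gens by blast
    then have eq: "(C6 [^]\<^bsub>SU3\<^esub> i ** C18 [^]\<^bsub>SU3\<^esub> j) ** (H1 [^]\<^bsub>SU3\<^esub> k ** H3 [^]\<^bsub>SU3\<^esub> l) = mat 1"
      "y = (c6 [^]\<^bsub>K\<^esub> i \<otimes>\<^bsub>K\<^esub> c18 [^]\<^bsub>K\<^esub> j) \<otimes>\<^bsub>K\<^esub> (h1 [^]\<^bsub>K\<^esub> k \<otimes>\<^bsub>K\<^esub> h3 [^]\<^bsub>K\<^esub> l)"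
      by (simp_all add: P_def pow_DirProd)
    have pow_1: "x [^]\<^bsub>K\<^esub> m = \<one>\<^bsub>K\<^esub>"
      if "n dvd m" "x [^]\<^bsub>K\<^esub> n = \<one>\<^bsub>K\<^esub>" "x \<in> carrier K" for x and m n :: nat
      using that by (auto elim!: dvdE simp flip: K.nat_pow_pow)
    have "c6 [^]\<^bsub>K\<^esub> i = \<one>\<^bsub>K\<^esub>" "c18 [^]\<^bsub>K\<^esub> j = \<one>\<^bsub>K\<^esub>" "h1 [^]\<^bsub>K\<^esub> k = \<one>\<^bsub>K\<^esub>" "h3 [^]\<^bsub>K\<^esub> l = \<one>\<^bsub>K\<^esub>"
      using normal_form_eq_1[OF eq(1)] K rels unfolding pres_rels_def by (metis pow_1)+
    then show ?thesis
      by (simp add: eq(2))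
  qed
  have in_P: "x \<in> carrier SU3 \<and> y \<in> carrier K" if "(x, y) \<in> \<Gamma>" for x y
    using that subgroup.subset[OF \<Gamma>] by (auto simp: P_def)
  have mult: "(x ** x', y \<otimes>\<^bsub>K\<^esub> y') \<in> \<Gamma>" if "(x, y) \<in> \<Gamma>" "(x', y') \<in> \<Gamma>" for x y x' y'
    using subgroup.m_closed[OF \<Gamma> that] by (simp add: P_def)
  \<comment> \<open>Two values over the same \<open>x\<close> differ by a value over the identity,
    which \<open>kernel\<close> makes trivial.\<close>
  have unique: "y = y'" if "(x, y) \<in> \<Gamma>" "(x, y') \<in> \<Gamma>" for x y y'
  proof -
    have carr: "x \<in> carrier SU3" "y \<in> carrier K" "y' \<in> carrier K"
      using in_P that by blast+
    have "inv\<^bsub>P\<^esub> (x, y') = (inv\<^bsub>SU3\<^esub> x, inv\<^bsub>K\<^esub> y')"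
      unfolding P_def using carr K(1) by (simp add: inv_DirProd)
    then have "(x ** inv\<^bsub>SU3\<^esub> x, y \<otimes>\<^bsub>K\<^esub> inv\<^bsub>K\<^esub> y') \<in> \<Gamma>"
      using mult[OF that(1)] subgroup.m_inv_closed[OF \<Gamma> that(2)] by simp
    then have "y \<otimes>\<^bsub>K\<^esub> inv\<^bsub>K\<^esub> y' = \<one>\<^bsub>K\<^esub>"
      using kernel SU3.r_inv[OF carr(1)] by simp
    then show ?thesis
      using carr K.inv_equality[of y "inv\<^bsub>K\<^esub> y'"] by simp
  qed
  interpret fst: group_hom P SU3 fst
    by unfold_locales (auto simp: hom_def P_def)
  \<comment> \<open>Totality: the projection carries the generators of the graph to generators of
    \<open>Fr648\<close>.\<close>
  have "fst ` \<Gamma> = Fr648"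
    using fst.generate_img[OF gens] by (simp add: \<Gamma>_def generate_C_H)
  then have total: "\<exists>y. (x, y) \<in> \<Gamma>" if "x \<in> Fr648" for x
    using that by force
  define \<phi> where "\<phi> x = (THE y. (x, y) \<in> \<Gamma>)" for x
  have \<phi>_eq: "\<phi> x = y" if "(x, y) \<in> \<Gamma>" for x y
    unfolding \<phi>_def using that unique by (blast intro: the_equality)
  have \<phi>_graph: "(x, \<phi> x) \<in> \<Gamma>" if "x \<in> Fr648" for x
    using total[OF that] \<phi>_eq by metis
  have "\<phi> \<in> hom (SU3\<lparr>carrier := Fr648\<rparr>) K"
  proof (rule homI)
    fix x y assume "x \<in> carrier (SU3\<lparr>carrier := Fr648\<rparr>)" "y \<in> carrier (SU3\<lparr>carrier := Fr648\<rparr>)"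
    then show "\<phi> (x \<otimes>\<^bsub>SU3\<lparr>carrier := Fr648\<rparr>\<^esub> y) = \<phi> x \<otimes>\<^bsub>K\<^esub> \<phi> y"
      using \<phi>_eq[OF mult[OF \<phi>_graph \<phi>_graph]] by simp
  qed (use in_P \<phi>_graph in auto)
  moreover have "(C6, c6) \<in> \<Gamma>" "(C18, c18) \<in> \<Gamma>" "(H1, h1) \<in> \<Gamma>" "(H3, h3) \<in> \<Gamma>"
    unfolding \<Gamma>_def by (auto intro: generate.incl)
  ultimately show ?thesis
    using \<phi>_eq by blast
qed

theorem theorem1:
  shows
  "subgroup Fr648 SU3 \<and> finite Fr648 \<and> card Fr648 = 648 \<and>
   subgroup Fr162 (SU3\<lparr>carrier := Fr648\<rparr>) \<and>
   SU3\<lparr>carrier := Fr162\<rparr> \<cong> SU3\<lparr>carrier := D9\<rparr> \<and>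
   \<comment> \<open>(a)\<close>
   NVset \<lhd> SU3\<lparr>carrier := Fr648\<rparr> \<and>
   SU3\<lparr>carrier := NVset\<rparr> \<cong> DirProd (SU3\<lparr>carrier := Nset\<rparr>) (SU3\<lparr>carrier := Vset\<rparr>) \<and>
   SU3\<lparr>carrier := NVset\<rparr> \<cong> DirProd (integer_mod_group 18) (integer_mod_group 6) \<and>
   subgroup Hset (SU3\<lparr>carrier := Fr648\<rparr>) \<and>
   SU3\<lparr>carrier := Hset\<rparr> \<cong> sym_group 3 \<and>
   NVset \<inter> Hset = {mat 1} \<and>
   NVset <#>\<^bsub>SU3\<^esub> Hset = Fr648 \<and>
   \<comment> \<open>(b)\<close>
   (\<forall>M \<in> Fr648. \<exists>!(i, j, T, H). i \<le> (8::nat) \<and> j \<le> (2::nat) \<and> T \<in> Vset \<and> H \<in> Hset \<and>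
        M = Amat [^]\<^bsub>SU3\<^esub> i ** Bmat [^]\<^bsub>SU3\<^esub> j ** T ** H) \<and>
   \<comment> \<open>(c)\<close>
   generate SU3 {C6, C18, H1, H3} = Fr648 \<and>
   pres_rels (SU3\<lparr>carrier := Fr648\<rparr>) C6 C18 H1 H3 \<and>
   (\<forall>(K :: 'g monoid) c6 c18 h1 h3.
      group K \<and> c6 \<in> carrier K \<and> c18 \<in> carrier K \<and> h1 \<in> carrier K \<and> h3 \<in> carrier K \<and>
      pres_rels K c6 c18 h1 h3 \<longrightarrow>
      (\<exists>\<phi>. \<phi> \<in> hom (SU3\<lparr>carrier := Fr648\<rparr>) K \<and>
           \<phi> C6 = c6 \<and> \<phi> C18 = c18 \<and> \<phi> H1 = h1 \<and> \<phi> H3 = h3))"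
proof -
  have sub: "subgroup Fr648 SU3"
    by (simp add: Fr648_eq subgroup_Mn)
  have "Fr162 \<subseteq> Fr648"
    using Mn_mono[of 1 2] by (simp add: Fr162_eq Fr648_eq)
  then have Fr162_sub: "subgroup Fr162 (SU3\<lparr>carrier := Fr648\<rparr>)"
    by (intro SU3.subgroup_incl sub) (simp_all add: Fr162_eq subgroup_Mn)
  have "Hset \<subseteq> Fr648"
    using MnI[of "mat 1" 1] Dg_Int_Hset[of 1] by (auto simp: Fr648_eq)
  then have Hset_sub: "subgroup Hset (SU3\<lparr>carrier := Fr648\<rparr>)"
    by (intro SU3.subgroup_incl sub subgroup_Hset)
  have product: "NVset <#>\<^bsub>SU3\<^esub> Hset = Fr648"
    unfolding set_mult_def NVset_eq Fr648_eq Mn_def by auto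
  have rels: "pres_rels (SU3\<lparr>carrier := Fr648\<rparr>) C6 C18 H1 H3"
  proof -
    have gens: "C6 \<in> Fr648" "C18 \<in> Fr648" "H1 \<in> Fr648" "H3 \<in> Fr648"
      by (simp_all add: Fr648_eq generators_in_Mn)
    \<comment> \<open>The inverse of this cube occurs in a relation, and inverses in the subgroup
      and in \<open>SU3\<close> are identified only for members.\<close>
    have "C18 [^]\<^bsub>SU3\<^esub> (3::nat) \<in> Fr648"
      using gens by (simp add: eval_nat_numeral subgroup.one_closed[OF sub, simplified]
          subgroup.m_closed[OF sub, simplified])
    with gens pres_rels_SU3 show ?thesis
      using sub by (simp add: pres_rels_def SU3.nat_pow_consistent[symmetric] SU3.m_inv_consistent)
  qed
  have trivial: "NVset \<inter> Hset = {mat 1}"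
    by (simp add: NVset_eq Dg_Int_Hset)
  show ?thesis
    by (intro conjI ballI allI impI Fr648_normal_form presentation_SU3 sub card_Fr648[THEN conjunct1]
        card_Fr648[THEN conjunct2] Fr162_sub Fr162_iso_D9 NVset_normal NVset_iso_product
        NVset_iso_cyclic Hset_sub Hset_iso_sym_group trivial product generate_C_H rels;
        (elim conjE)?; assumption)
qed

end
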